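(* Let $t\ge 3$ and let $\Sigma$ be a $q$-order canonical subgeometry of $\mathrm{PG}(t-1,q^t)$. Let $\ell$ be a line of $\mathrm{PG}(t-1,q^t)$ disjoint from $\Sigma$ and not contained in the span of any hyperplane of $\Sigma$. Then the splash $\mathbb{L}$ of $\Sigma$ on $\ell$ is a scattered $\mathbb{F}_q$-linear set of pseudoregulus type if and only if there exists a generator $\hat\sigma$ of the subgroup of $\mathrm{P\Gamma L}(t,q^t)$ fixing $\Sigma$ pointwise such that $\ell\cap\ell^{\hat\sigma}\neq\emptyset$. In this case the transversal points of $\mathbb{L}$ are $\ell\cap\ell^{\hat\sigma}$ and $\ell\cap\ell^{\hat\sigma^{-1}}$.
   Context: A $q$-order canonical subgeometry of $\mathrm{PG}(t-1,q^t)=\mathrm{PG}_{q^t}(V)$ is $\Sigma=\{\langle w\rangle_{q^t}: w\in W\setminus\{0\}\}$ for a $t$-dimensional $\mathbb{F}_q$-subspace $W$ of $V$ with $\Sigma$ spanning $\mathrm{PG}(t-1,q^t)$; it is isomorphic to $\mathrm{PG}(t-1,q)$, and the span of a hyperplane of $\Sigma$ is the $\mathrm{PG}(t-2,q^t)$ it generates. The subgroup of $\mathrm{P\Gamma L}(t,q^t)$ fixing $\Sigma$ pointwise is cyclic of order $t$ (in coordinates where $\Sigma$ consists of the points with all coordinates in $\mathbb{F}_q$, it consists of the coordinatewise Galois maps). The splash of $\Sigma$ on $\ell$ is the set of points $\ell\cap\langle H\rangle$ where $H$ ranges over the hyperplanes of $\Sigma$. An $\mathbb{F}_q$-linear set of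 $\mathrm{PG}(1,q^t)$ of rank $n$ is a set $\{P:\mathcal{F}(P)\cap S\neq\emptyset\}$, $S$ an $(n-1)$-subspace of $\mathrm{PG}(2t-1,q)=\mathrm{PG}_q(\mathbb{F}_{q^t}^2)$, where $\mathcal{F}(\langle u\rangle_{q^t})$ is the set of one-dimensional $\mathbb{F}_q$-subspaces of $\langle u\rangle_{q^t}$; it is scattered if it has $(q^n-1)/(q-1)$ points. A point set $\mathbb{L}$ of $\mathrm{PG}(1,q^t)$ (here $\ell$) is of pseudoregulus type if some projectivity $\phi$ maps $\{\langle(\lambda,\lambda^q)\rangle_{q^t}:\lambda\in\mathbb{F}_{q^t}^*\}$ onto $\mathbb{L}$; the points $\langle(1,0)\rangle^\phi,\langle(0,1)\rangle^\phi$ are its two transversal points. *)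

theory Defs
  imports "HOL-Analysis.Analysis" "HOL-Algebra.Bij" "HOL-Algebra.Generated_Groups"
begin

text \<open>
  The field of order \<open>q\<^sup>t\<close> is a finite field type \<open>'a\<close>, its subfield of order \<open>q\<close> is a finite
  field type \<open>'k\<close> together with an embedding \<open>emb\<close> of \<open>'k\<close> into \<open>'a\<close>, and \<open>V = 'a ^ 'n\<close>
  with \<open>t = CARD('n)\<close>.  Over \<open>'a\<close> the linear algebra is that of the interpretation \<open>vec\<close>
  (\<open>vec.span\<close>, \<open>vec.subspace\<close>, \<open>vec.dim\<close>); over \<open>'k\<close> it is that of the locale
  \<open>vector_space\<close> for the restricted scalar multiplication \<open>kscale emb\<close>.
\<close>

definition field_embedding :: "('k::field \<Rightarrow> 'a::field) \<Rightarrow> bool" where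
  "field_embedding emb \<longleftrightarrow> emb 1 = 1
     \<and> (\<forall>x y. emb (x + y) = emb x + emb y) \<and> (\<forall>x y. emb (x * y) = emb x * emb y)"

definition kscale :: "('k::field \<Rightarrow> 'a::field) \<Rightarrow> 'k \<Rightarrow> 'a ^ 'n \<Rightarrow> 'a ^ 'n" where
  "kscale emb c v = emb c *s v"

lemma vector_space_kscale:
  "field_embedding emb \<Longrightarrow> vector_space (kscale emb :: 'k::field \<Rightarrow> 'a::field ^ 'n \<Rightarrow> 'a ^ 'n)"
  by unfold_locales
    (simp_all add: field_embedding_def kscale_def vec.scale_right_distrib vec.scale_left_distrib)

abbreviation ksubspace :: "('k::field \<Rightarrow> 'a::field) \<Rightarrow> ('a ^ 'n) set \<Rightarrow> bool" where
  "ksubspace emb \<equiv> module.subspace (kscale emb)"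

abbreviation kspan :: "('k::field \<Rightarrow> 'a::field) \<Rightarrow> ('a ^ 'n) set \<Rightarrow> ('a ^ 'n) set" where
  "kspan emb \<equiv> module.span (kscale emb)"

abbreviation kdim :: "('k::field \<Rightarrow> 'a::field) \<Rightarrow> ('a ^ 'n) set \<Rightarrow> nat" where
  "kdim emb \<equiv> vector_space.dim (kscale emb)"

text \<open>
  A point of a projective space is a one-dimensional subspace (a set of vectors).
  \<open>PG U\<close> is the set of points over \<open>'a\<close> represented by the nonzero vectors of \<open>U\<close>;
  \<open>U\<close> may be an \<open>'a\<close>-subspace or merely a \<open>'k\<close>-subspace.
  \<open>PGk emb U\<close> is the set of points over \<open>'k\<close> of a \<open>'k\<close>-subspace \<open>U\<close>; in particular
  \<open>PGk emb P\<close> is \<open>\<F>(P)\<close> for a point \<open>P\<close> over \<open>'a\<close>.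
\<close>

definition PG :: "('a::field ^ 'n) set \<Rightarrow> ('a ^ 'n) set set" where
  "PG U = {vec.span {u} | u. u \<in> U \<and> u \<noteq> 0}"

definition PGk :: "('k::field \<Rightarrow> 'a::field) \<Rightarrow> ('a ^ 'n) set \<Rightarrow> ('a ^ 'n) set set" where
  "PGk emb U = {kspan emb {u} | u. u \<in> U \<and> u \<noteq> 0}"

definition proj_span :: "('a::field ^ 'n) set set \<Rightarrow> ('a ^ 'n) set set" where
  "proj_span X = PG (vec.span (\<Union>X))"

definition canonical_subgeometry ::
    "('k::field \<Rightarrow> 'a::field) \<Rightarrow> ('a ^ 'n) set \<Rightarrow> ('a ^ 'n) set set \<Rightarrow> bool" where
  "canonical_subgeometry emb W \<Sigma> \<longleftrightarrow>
     ksubspace emb W \<and> kdim emb W = CARD('n) \<and> \<Sigma> = PG W \<and> proj_span \<Sigma> = PG UNIV"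

definition sub_hyperplanes ::
    "('k::field \<Rightarrow> 'a::field) \<Rightarrow> ('a ^ 'n) set \<Rightarrow> ('a ^ 'n) set set set" where
  "sub_hyperplanes emb W =
     {PG H | H. H \<subseteq> W \<and> ksubspace emb H \<and> kdim emb H = kdim emb W - 1}"

definition splash ::
    "('k::field \<Rightarrow> 'a::field) \<Rightarrow> ('a ^ 'n) set \<Rightarrow> ('a ^ 'n) set set \<Rightarrow> ('a ^ 'n) set set" where
  "splash emb W ell = {P. \<exists>H \<in> sub_hyperplanes emb W. ell \<inter> proj_span H = {P}}"

text \<open>
  Collineations are represented as elements of \<open>BijGroup (PG UNIV)\<close>, that is, as
  permutations of the point set that are \<open>undefined\<close> outside of it.
\<close>

definition semilinear :: "('a::field \<Rightarrow> 'a) \<Rightarrow> ('a ^ 'n \<Rightarrow> 'a ^ 'n) \<Rightarrow> bool" where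
  "semilinear \<theta> f \<longleftrightarrow> (\<forall>x y. f (x + y) = f x + f y) \<and> (\<forall>c x. f (c *s x) = \<theta> c *s f x)"

definition PGammaL :: "(('a::field ^ 'n) set \<Rightarrow> ('a ^ 'n) set) set" where
  "PGammaL = {restrict (\<lambda>P. f ` P) (PG UNIV) | f.
     bij f \<and> (\<exists>\<theta>. field_embedding \<theta> \<and> bij \<theta> \<and> semilinear \<theta> f)}"

definition pointwise_stabilizer ::
    "('a::field ^ 'n) set set \<Rightarrow> (('a ^ 'n) set \<Rightarrow> ('a ^ 'n) set) set" where
  "pointwise_stabilizer \<Sigma> = {g \<in> PGammaL. \<forall>P \<in> \<Sigma>. g P = P}"

definition stabilizer_generator ::
    "('a::field ^ 'n) set set \<Rightarrow> (('a ^ 'n) set \<Rightarrow> ('a ^ 'n) set) \<Rightarrow> bool" where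
  "stabilizer_generator \<Sigma> g \<longleftrightarrow> g \<in> pointwise_stabilizer \<Sigma>
     \<and> generate (BijGroup (PG UNIV)) {g} = pointwise_stabilizer \<Sigma>"

text \<open>
  In the following, \<open>L\<close> is the two-dimensional subspace underlying the line \<open>PG L\<close>, which
  plays the role of \<open>PG(1,q\<^sup>t)\<close>; an \<open>(n-1)\<close>-subspace of \<open>PG(2t-1,q)\<close> is \<open>PGk emb U\<close> for an
  \<open>n\<close>-dimensional \<open>'k\<close>-subspace \<open>U\<close> of \<open>L\<close>.
\<close>

definition linear_set ::
    "('k::field \<Rightarrow> 'a::field) \<Rightarrow> ('a ^ 'n) set \<Rightarrow> nat \<Rightarrow> ('a ^ 'n) set set \<Rightarrow> bool" where
  "linear_set emb L n X \<longleftrightarrow> (\<exists>U \<subseteq> L. ksubspace emb U \<and> kdim emb U = n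
     \<and> X = {P \<in> PG L. PGk emb P \<inter> PGk emb U \<noteq> {}})"

definition scattered_linear_set ::
    "('k::field \<Rightarrow> 'a::field) \<Rightarrow> ('a ^ 'n) set \<Rightarrow> ('a ^ 'n) set set \<Rightarrow> bool" where
  "scattered_linear_set emb L X \<longleftrightarrow>
     (\<exists>n \<ge> 1. linear_set emb L n X \<and> card X = (CARD('k) ^ n - 1) div (CARD('k) - 1))"

definition projectivity_onto ::
    "('a::field ^ 'n) set \<Rightarrow> (('a ^ 2) set \<Rightarrow> ('a ^ 'n) set) \<Rightarrow> bool" where
  "projectivity_onto L \<phi> \<longleftrightarrow> (\<exists>f. Vector_Spaces.linear (*s) (*s) f \<and> inj f \<and> range f = L
     \<and> (\<forall>P \<in> PG UNIV. \<phi> P = f ` P))"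

definition pseudoregulus_model :: "nat \<Rightarrow> ('a::field ^ 2) set set" where
  "pseudoregulus_model q = {vec.span {vector [c, c ^ q]} | c. c \<noteq> 0}"

definition pseudoregulus_type ::
    "nat \<Rightarrow> ('a::field ^ 'n) set \<Rightarrow> ('a ^ 'n) set set \<Rightarrow> bool" where
  "pseudoregulus_type q L X \<longleftrightarrow> (\<exists>\<phi>. projectivity_onto L \<phi> \<and> \<phi> ` pseudoregulus_model q = X)"

text \<open>
  The projectivity \<open>\<phi>\<close> is not unique, so the images of \<open>\<langle>(1,0)\<rangle>\<close> and \<open>\<langle>(0,1)\<rangle>\<close> are collected
  over all admissible \<open>\<phi>\<close>.  That \<open>transversal_points q L X = {P, Q}\<close> therefore includes that
  this unordered pair does not depend on \<open>\<phi>\<close>.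
\<close>

definition transversal_points ::
    "nat \<Rightarrow> ('a::field ^ 'n) set \<Rightarrow> ('a ^ 'n) set set \<Rightarrow> ('a ^ 'n) set set" where
  "transversal_points q L X =
     (\<Union>\<phi> \<in> {\<phi>. projectivity_onto L \<phi> \<and> \<phi> ` pseudoregulus_model q = X}.
        {\<phi> (vec.span {vector [1, 0]}), \<phi> (vec.span {vector [0, 1]})})"

end

theory Submission
  imports Defs "HOL-Computational_Algebra.Polynomial" "HOL-Number_Theory.Cong"
begin

text \<open>
  Choose coordinates in which the points of \<open>\<Sigma>\<close> are those with coordinates in \<open>GF(q)\<close>.
  The hyperplanes of \<open>\<Sigma>\<close> are then the kernels of the forms \<open>a\<close> with coefficients in
  \<open>GF(q)\<close>, and if \<open>u, v\<close> is a basis of the line, the splash consists of the points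
  \<open>\<langle>a(v) u - a(u) v\<rangle>\<close>.

  If \<open>v = u\<^sup>\<sigma>\<close> for a generator \<open>\<sigma>\<close>, then \<open>a(v) = a(u)\<^sup>\<sigma>\<close> and \<open>a(u)\<close> runs through the
  whole field, so the splash is of pseudoregulus type with transversal points \<open>\<langle>u\<rangle>, \<langle>v\<rangle>\<close>.
  Conversely, if the splash is of pseudoregulus type, then for a suitable basis the ratios
  \<open>a(v) / a(u)\<close> are the \<open>(q-1)\<close>-st powers. The conjugates of \<open>u\<close> under the powers of
  \<open>x \<mapsto> x\<^sup>q\<close> form a basis of \<open>V\<close>, whence \<open>a(v) = g(a(u))\<close> for a linearized polynomial \<open>g\<close>
  such that \<open>g(x) / x\<close> takes the same values as \<open>x\<^sup>q / x\<close>. Comparing the power sums of these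
  values shows that \<open>g\<close> is a monomial \<open>c x\<^sup>r\<close>, where \<open>r\<close> is the \<open>s\<close>-th power of \<open>q\<close> and
  \<open>s\<close> is coprime to \<open>t\<close>; so \<open>\<langle>v\<rangle>\<close> is a conjugate of \<open>\<langle>u\<rangle>\<close>. The linear independence of
  the conjugates of \<open>u\<close> also shows that no other pair of points is transversal.
\<close>

section \<open>Finite fields\<close>

text \<open>The hypothesis on the splash is an equality of sets, whereas power sums count values
  with multiplicity. Additivity of g reconciles the two: the solutions of g(x) = m x form an
  additive group, so each value m of g(x) / x is taken at a number of nonzero x that equals -1 in
  the field. An arbitrary power sum would only give a polynomial relation between the coefficients
  of g. The exponent is therefore built from a shortest cycle, for which a single product of powers
  of nonzero coefficients is left over and would have to vanish.

  In the direction from a generator to the splash, disjointness from \<Sigma> makes u and its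
  conjugate independent: a point fixed by a generator is fixed by the coordinatewise q-th power,
  hence belongs to \<Sigma>. That the line lies in no span of a hyperplane of \<Sigma> then makes
  a(u) nonzero for all forms a other than 0. For t at least 3 a generator differs from its inverse,
  which keeps the two intersection points apart.\<close>

lemma power_card_eq_self:
  fixes x :: "'a::{field,finite}"
  shows "x ^ CARD('a) = x"
proof (cases "x = 0")
  case False
  let ?U = "UNIV - {0::'a}"
  have "bij_betw ((*) x) ?U ?U"
    by (rule bij_betwI[where g = "\<lambda>y. y / x"]) (use False in auto)
  then have "(\<Prod>y\<in>?U. x * y) = (\<Prod>y\<in>?U. y)"
    by (rule prod.reindex_bij_betw)
  then have "x ^ card ?U * (\<Prod>y\<in>?U. y) = (\<Prod>y\<in>?U. y)"
    by (simp add: prod.distrib)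
  moreover have "(\<Prod>y\<in>?U. y) \<noteq> 0"
    by simp
  ultimately have "x ^ card ?U = 1"
    by simp
  moreover have "CARD('a) = Suc (card ?U)"
    by (rule card_Suc_Diff1[symmetric]) simp_all
  ultimately show ?thesis
    by (simp only: power_Suc mult_1_right)
qed (simp add: zero_power)

text \<open>Translation by \<open>y\<close> permutes \<open>G\<close>, so the sum over
  \<open>G\<close> does not change although \<open>y\<close> is added \<open>card G\<close>
  times.\<close>

lemma of_nat_card_eq_0_if_add_closed:
  fixes G :: "'a::{field,finite} set"
  assumes "\<And>x y. x \<in> G \<Longrightarrow> y \<in> G \<Longrightarrow> x + y \<in> G" "y \<in> G" "y \<noteq> 0"
  shows "of_nat (card G) = (0::'a)"
proof -
  have "(\<lambda>x. x + y) ` G = G"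
    by (rule endo_inj_surj) (use assms in \<open>auto simp: inj_on_def\<close>)
  then have "(\<Sum>x\<in>G. x + y) = (\<Sum>x\<in>G. x)"
    using sum.reindex[of "\<lambda>x. x + y" G "\<lambda>x. x"] by (simp add: inj_on_def)
  then show ?thesis
    using assms(3) by (simp add: sum.distrib)
qed

text \<open>The solutions \<open>x\<close> of \<open>g x = m * x\<close> form an additive group,
  whose size is 0 in the field once it has a nonzero element. Without the solution 0, each attained
  ratio therefore counts -1 times, whatever \<open>g\<close> is. Hence sums over the field depend
  only on the set of ratios.\<close>

lemma sum_ratio_additive:
  fixes g h :: "'a::{field,finite} \<Rightarrow> 'a"
  assumes "\<And>x y. g (x + y) = g x + g y"
  shows "(\<Sum>x\<in>UNIV - {0}. h (g x / x)) = - (\<Sum>m\<in>(\<lambda>x. g x / x) ` (UNIV - {0}). h m)"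
proof -
  have fibre: "of_nat (card {x \<in> UNIV - {0}. g x / x = g z / z}) = (- 1 :: 'a)" if "z \<noteq> 0" for z
  proof -
    let ?G = "{x. g x = g z / z * x}"
    have g0: "g 0 = 0"
      using assms[of 0 0] by (metis add_0_right add_left_cancel)
    have "of_nat (card ?G) = (0::'a)"
      by (rule of_nat_card_eq_0_if_add_closed[of _ z])
        (use that assms in \<open>auto simp: algebra_simps add_divide_distrib\<close>)
    moreover have "?G = insert 0 {x \<in> UNIV - {0}. g x / x = g z / z}"
      using g0 by (auto simp: nonzero_divide_eq_eq)
    ultimately show ?thesis
      by (simp add: eq_neg_iff_add_eq_0 add.commute)
  qed
  have "(\<Sum>x\<in>UNIV - {0}. h (g x / x))
      = (\<Sum>m\<in>(\<lambda>x. g x / x) ` (UNIV - {0}). \<Sum>x\<in>{x \<in> UNIV - {0}. g x / x = m}. h (g x / x))"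
    by (rule sum.image_gen) simp
  also have "\<dots> = (\<Sum>m\<in>(\<lambda>x. g x / x) ` (UNIV - {0}). - h m)"
  proof (rule sum.cong)
    fix m assume "m \<in> (\<lambda>x. g x / x) ` (UNIV - {0})"
    then obtain z where z: "z \<noteq> 0" "m = g z / z"
      by auto
    have "(\<Sum>x\<in>{x \<in> UNIV - {0}. g x / x = m}. h (g x / x))
        = (\<Sum>x\<in>{x \<in> UNIV - {0}. g x / x = m}. h m)"
      by (rule sum.cong) auto
    also have "\<dots> = of_nat (card {x \<in> UNIV - {0}. g x / x = m}) * h m"
      by simp
    also have "\<dots> = - h m"
      using fibre[OF z(1)] z(2) by simp
    finally show "(\<Sum>x\<in>{x \<in> UNIV - {0}. g x / x = m}. h (g x / x)) = - h m" .
  qed simp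
  finally show ?thesis
    by (simp add: sum_negf)
qed

text \<open>Substituting \<open>y * x\<close> for \<open>x\<close> permutes the nonzero elements and
  multiplies the sum by \<open>c\<close>. This is what kills sums of powers whose exponents do not
  act trivially.\<close>

lemma sum_nonzero_eq_0_if_scales:
  fixes F :: "'a::{field,finite} \<Rightarrow> 'a"
  assumes "y \<noteq> 0" "c \<noteq> 1" "\<And>x. x \<noteq> 0 \<Longrightarrow> F (y * x) = c * F x"
  shows "(\<Sum>x\<in>UNIV - {0}. F x) = 0"
proof -
  have "bij_betw ((*) y) (UNIV - {0}) (UNIV - {0})"
    by (rule bij_betwI[where g = "\<lambda>x. x / y"]) (use assms in auto)
  then have "(\<Sum>x\<in>UNIV - {0}. F (y * x)) = (\<Sum>x\<in>UNIV - {0}. F x)"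
    by (rule sum.reindex_bij_betw)
  moreover have "(\<Sum>x\<in>UNIV - {0}. F (y * x)) = c * (\<Sum>x\<in>UNIV - {0}. F x)"
    unfolding sum_distrib_left by (rule sum.cong) (use assms(3) in auto)
  ultimately have "(c - 1) * (\<Sum>x\<in>UNIV - {0}. F x) = 0"
    by (simp add: algebra_simps)
  then show ?thesis
    using assms(2) by simp
qed

text \<open>Counting the roots of \<open>X ^ e - 1\<close> takes the place of a primitive
  element.\<close>

lemma ex_power_neq_1:
  assumes "0 < e" "e < CARD('a::{field,finite}) - 1"
  shows "\<exists>y::'a. y \<noteq> 0 \<and> y ^ e \<noteq> 1"
proof (rule ccontr)
  assume "\<not> ?thesis"
  then have roots: "UNIV - {0::'a} \<subseteq> {y. poly (monom 1 e - 1) y = 0}"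
    by (auto simp: poly_monom)
  have nz: "monom 1 e - 1 \<noteq> (0::'a poly)"
  proof
    assume "monom 1 e - 1 = (0::'a poly)"
    then have "coeff (monom 1 e - 1) e = (0::'a)"
      by (metis coeff_0)
    then show False
      using assms(1) by simp
  qed
  have "degree (monom 1 e - 1 :: 'a poly) \<le> e"
    by (rule degree_diff_le) (auto simp: degree_monom_le)
  moreover have "card {y. poly (monom 1 e - 1) y = (0::'a)} \<le> degree (monom 1 e - 1 :: 'a poly)"
    by (rule card_poly_roots_bound[OF nz])
  moreover have "CARD('a) - 1 \<le> card {y. poly (monom 1 e - 1) y = (0::'a)}"
    using card_mono[OF _ roots] by (simp add: card_Diff_singleton)
  ultimately show False
    using assms(2) by linarith
qed

section \<open>Expansions in base \<open>q\<close>\<close>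

lemma sum_digits_less:
  fixes c :: "nat \<Rightarrow> nat"
  assumes "\<And>i. i < t \<Longrightarrow> c i < q"
  shows "(\<Sum>i<t. c i * q ^ i) < q ^ t"
  using assms
proof (induction t)
  case (Suc t)
  have "(\<Sum>i<t. c i * q ^ i) < q ^ t"
    using Suc by simp
  moreover have "(c t + 1) * q ^ t \<le> q * q ^ t"
    using Suc.prems[of t] by (intro mult_right_mono) auto
  ultimately show ?case
    by (simp add: add.commute)
qed simp

lemma digits_unique:
  fixes c d :: "nat \<Rightarrow> nat"
  assumes "\<And>i. i < t \<Longrightarrow> c i < q" "\<And>i. i < t \<Longrightarrow> d i < q"
    and "(\<Sum>i<t. c i * q ^ i) = (\<Sum>i<t. d i * q ^ i)" "i < t"
  shows "c i = d i"
  using assms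
proof (induction t)
  case (Suc t)
  have lt: "(\<Sum>i<t. c i * q ^ i) < q ^ t" "(\<Sum>i<t. d i * q ^ i) < q ^ t"
    using Suc.prems by (auto intro!: sum_digits_less)
  have eq: "(\<Sum>i<t. c i * q ^ i) + c t * q ^ t = (\<Sum>i<t. d i * q ^ i) + d t * q ^ t"
    using Suc.prems(3) by simp
  have "(a + b * q ^ t) div q ^ t = b" if "a < q ^ t" for a b
    using that by (cases "q = 0"; cases "t = 0") (auto simp: zero_power)
  then have top: "c t = d t"
    using eq lt by metis
  show ?case
  proof (cases "i = t")
    case False
    then show ?thesis
      using Suc top eq by (intro Suc.IH) auto
  qed (simp add: top)
qed simp

text \<open>This is the factorization of \<open>q ^ s - 1\<close> as \<open>q - 1\<close> times a
  geometric sum, written without subtraction. For nonzero \<open>x\<close> it shows that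
  \<open>x ^ (q ^ s) / x\<close> has the form \<open>y ^ q / y\<close>, with \<open>y\<close> the
  power of \<open>x\<close> by the geometric sum.\<close>

lemma power_power_split:
  fixes x :: "'a::comm_monoid_mult"
  shows "x ^ (q ^ s) * x ^ (\<Sum>i<s. q ^ i) = x * (x ^ (\<Sum>i<s. q ^ i)) ^ q"
proof -
  have "q ^ s + (\<Sum>i<s. q ^ i) = Suc ((\<Sum>i<s. q ^ i) * q)"
  proof (induction s)
    case (Suc s)
    have "q ^ Suc s + (\<Sum>i<Suc s. q ^ i) = q ^ s * q + (q ^ s + (\<Sum>i<s. q ^ i))"
      by simp
    also have "\<dots> = q ^ s * q + Suc ((\<Sum>i<s. q ^ i) * q)"
      by (simp only: Suc)
    also have "\<dots> = Suc ((\<Sum>i<Suc s. q ^ i) * q)"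
      by (simp add: add_mult_distrib)
    finally show ?case .
  qed simp
  then have "x ^ (q ^ s) * x ^ (\<Sum>i<s. q ^ i) = x ^ Suc ((\<Sum>i<s. q ^ i) * q)"
    by (simp only: flip: power_add)
  then show ?thesis
    by (simp only: power_Suc power_mult)
qed

section \<open>The extension of degree \<open>t\<close> and the powers of its Frobenius map\<close>

locale finite_field_extension =
  fixes emb :: "'k::{field,finite} \<Rightarrow> 'a::{field,finite}" and q t :: nat
  assumes card_k: "CARD('k) = q" and card_a: "CARD('a) = q ^ t"
    and field_embedding_emb: "field_embedding emb" and t_ge_3: "3 \<le> t"
begin

lemma emb_1 [simp]: "emb 1 = 1"
  and emb_add: "emb (x + y) = emb x + emb y"
  and emb_mult: "emb (x * y) = emb x * emb y"
  using field_embedding_emb by (auto simp: field_embedding_def)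

lemma emb_0 [simp]: "emb 0 = 0"
  using emb_add[of 0 0] by (metis add_0_right add_left_cancel)

lemma emb_minus: "emb (- x) = - emb x"
  using emb_add[of x "- x"] by (simp add: eq_neg_iff_add_eq_0 add.commute)

lemma emb_diff: "emb (x - y) = emb x - emb y"
  using emb_add[of x "- y"] by (simp add: emb_minus)

lemma emb_eq_0_iff [simp]: "emb x = 0 \<longleftrightarrow> x = 0"
proof
  assume "emb x = 0"
  then show "x = 0"
    using emb_mult[of x "inverse x"] by (cases "x = 0") auto
qed simp

lemma inj_emb: "inj emb"
  by (rule injI) (metis emb_diff emb_eq_0_iff right_minus_eq)

lemma emb_power: "emb (x ^ n) = emb x ^ n"
  by (induction n) (auto simp: emb_mult)

lemma emb_of_nat: "emb (of_nat n) = of_nat n"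
  by (induction n) (auto simp: emb_add)

lemma q_ge_2: "2 \<le> q"
  using card_mono[of UNIV "{0, 1 :: 'k}"] by (simp add: card_k)

lemma emb_power_q: "emb x ^ q = emb x"
  using power_card_eq_self[of x] by (simp add: card_k flip: emb_power)

text \<open>The \<open>q\<close> elements of the subfield exhaust the roots of
  \<open>X ^ q - X\<close>.\<close>

lemma power_q_eq_self_iff: "x ^ q = x \<longleftrightarrow> x \<in> range emb"
proof -
  let ?p = "monom 1 q - monom 1 1 :: 'a poly"
  have nz: "?p \<noteq> 0"
  proof
    assume "?p = 0"
    then have "coeff ?p q = 0"
      by (metis coeff_0)
    then show False
      using q_ge_2 by simp
  qed
  have "degree ?p \<le> q"
    by (rule degree_diff_le) (use q_ge_2 in \<open>auto intro: order_trans[OF degree_monom_le]\<close>)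
  then have "card {x. poly ?p x = 0} \<le> q"
    using card_poly_roots_bound[OF nz] by linarith
  moreover have "range emb \<subseteq> {x. poly ?p x = 0}"
    by (auto simp: poly_monom emb_power_q)
  moreover have "card (range emb) = q"
    using inj_emb by (simp add: card_image card_k)
  ultimately have "range emb = {x. poly ?p x = 0}"
    by (intro card_seteq) auto
  then show ?thesis
    by (auto simp: poly_monom)
qed

text \<open>The polynomial \<open>(1 + X) ^ q - (X ^ q + 1)\<close> over the small field has degree
  below \<open>q\<close> but vanishes at all \<open>q\<close> elements, so it is zero and its
  coefficients can be read off. The prime of which \<open>q\<close> is a power need not be
  extracted.\<close>

lemma of_nat_binomial_q:
  assumes "0 < i" "i < q"
  shows "of_nat (q choose i) = (0::'a)"
proof -
  let ?p = "[:1, 1:] ^ q - (monom 1 q + 1) :: 'k poly"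
  have "?p = 0"
  proof (rule ccontr)
    assume nz: "?p \<noteq> 0"
    have "degree ?p \<le> q"
      by (intro degree_diff_le degree_add_le) (auto simp: degree_monom_le degree_linear_power)
    moreover have "coeff ?p q = 0"
      using q_ge_2 by (simp add: coeff_linear_poly_power)
    ultimately have "degree ?p < q"
      using nz by (metis leading_coeff_0_iff le_neq_implies_less)
    moreover have "{x. poly ?p x = 0} = UNIV"
      by (simp add: poly_monom power_card_eq_self add.commute flip: card_k)
    ultimately show False
      using card_poly_roots_bound[OF nz] by (simp add: card_k)
  qed
  then have "coeff ?p i = 0"
    by (metis coeff_0)
  then have "of_nat (q choose i) = (0::'k)"
    using assms by (simp add: coeff_linear_poly_power)
  then show ?thesis
    by (metis emb_of_nat emb_0)
qed

lemma power_q_add: "(x + y :: 'a) ^ q = x ^ q + y ^ q"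
proof -
  have "(x + y) ^ q = (\<Sum>i\<le>q. of_nat (q choose i) * x ^ i * y ^ (q - i))"
    by (rule binomial_ring)
  also have "\<dots> = (\<Sum>i\<in>{0, q}. of_nat (q choose i) * x ^ i * y ^ (q - i))"
    by (rule sum.mono_neutral_right) (auto simp: of_nat_binomial_q)
  also have "\<dots> = x ^ q + y ^ q"
    using q_ge_2 by simp
  finally show ?thesis .
qed

lemma frob_add: "(x + y :: 'a) ^ (q ^ j) = x ^ (q ^ j) + y ^ (q ^ j)"
proof (induction j)
  case (Suc j)
  then show ?case
    by (simp only: power_Suc2 power_mult power_q_add)
qed simp

lemma frob_sum: "(\<Sum>i\<in>I. f i :: 'a) ^ (q ^ j) = (\<Sum>i\<in>I. f i ^ (q ^ j))"
  by (induction I rule: infinite_finite_induct) (use q_ge_2 in \<open>auto simp: frob_add zero_power\<close>)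

lemma frob_emb: "emb x ^ (q ^ j) = emb x"
proof (induction j)
  case (Suc j)
  then show ?case
    by (simp only: power_Suc2 power_mult emb_power_q)
qed simp

lemma frob_mod: "(x::'a) ^ (q ^ (j mod t)) = x ^ (q ^ j)"
proof -
  have t: "x ^ (q ^ t) = x" for x :: 'a
    using power_card_eq_self[of x] by (simp add: card_a)
  have "x ^ (q ^ (n * t + i)) = x ^ (q ^ i)" for n i
  proof (induction n)
    case (Suc n)
    have "x ^ (q ^ (Suc n * t + i)) = (x ^ (q ^ t)) ^ (q ^ (n * t + i))"
      by (simp only: power_add power_mult mult_Suc add.assoc)
    then show ?case
      using Suc t by simp
  qed simp
  then show ?thesis
    by (metis div_mult_mod_eq)
qed

lemma frob_compose: "((x::'a) ^ (q ^ i)) ^ (q ^ j) = x ^ (q ^ ((i + j) mod t))"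
  by (simp only: frob_mod power_add power_mult)

text \<open>A polynomial of degree at most \<open>q ^ (t - 1)\<close> cannot have all
  \<open>q ^ t\<close> elements as roots unless it is zero, and the exponents \<open>q ^ j\<close>
  are distinct.\<close>

lemma frob_independent:
  fixes c :: "nat \<Rightarrow> 'a"
  assumes "\<And>x. (\<Sum>j<t. c j * x ^ (q ^ j)) = 0" "j < t"
  shows "c j = 0"
proof -
  let ?p = "\<Sum>j<t. monom (c j) (q ^ j)"
  have inj: "q ^ i = q ^ j \<longleftrightarrow> i = j" for i j
    using q_ge_2 by simp
  have "degree ?p \<le> q ^ (t - 1)"
    by (rule degree_sum_le)
      (use q_ge_2 in \<open>auto intro!: order_trans[OF degree_monom_le] power_increasing\<close>)
  also have "\<dots> < q ^ t"
    using q_ge_2 t_ge_3 by simp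
  finally have "degree ?p < CARD('a)"
    by (simp add: card_a)
  moreover have "{x. poly ?p x = 0} = UNIV"
    using assms(1) by (simp add: poly_sum poly_monom)
  ultimately have "?p = 0"
    using card_poly_roots_bound[of ?p] by (metis not_le)
  then have "coeff ?p (q ^ j) = 0"
    by (metis coeff_0)
  moreover have "coeff ?p (q ^ j) = (\<Sum>i<t. if i = j then c i else 0)"
    by (simp add: coeff_sum inj)
  ultimately show ?thesis
    using assms(2) by simp
qed

text \<open>
  A carry in base \<open>q\<close> replaces \<open>q\<close> summands by one, so among the ways of writing an exponent
  as a sum of powers of \<open>q\<close> (with \<open>q\<^sup>t\<close> identified with \<open>1\<close>), the base-\<open>q\<close> expansion is the
  unique shortest one.
\<close>

lemma minimal_expansion_unique:
  fixes c :: "nat \<Rightarrow> nat"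
  assumes "S \<subset> {..<t}" "(\<Sum>i<t. c i) \<le> card S"
    and "\<And>x::'a. x \<noteq> 0 \<Longrightarrow> x ^ (\<Sum>i<t. c i * q ^ i) = x ^ (\<Sum>i\<in>S. q ^ i)" "i < t"
  shows "c i = (if i \<in> S then 1 else 0)"
  using assms(2-4)
proof (induction "\<Sum>i<t. c i" arbitrary: c i rule: less_induct)
  case less
  let ?e = "\<lambda>i. if i \<in> S then 1 else 0 :: nat"
  have finS: "finite S"
    using assms(1) finite_subset by auto
  have sum_S: "(\<Sum>i\<in>S. f i) = (\<Sum>i<t. ?e i * f i)" for f :: "nat \<Rightarrow> nat"
  proof -
    have "(\<Sum>i<t. ?e i * f i) = (\<Sum>i\<in>S. ?e i * f i)"
      by (rule sum.mono_neutral_right) (use assms(1) in auto)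
    then show ?thesis by simp
  qed
  show ?case
  proof (cases "\<exists>i<t. q \<le> c i")
    case True
    then obtain i where i: "i < t" "q \<le> c i"
      by blast
    \<comment> \<open>The carry goes from position \<open>i\<close> to the next one, cyclically,
      because the exponents \<open>q ^ t\<close> and 1 act alike.\<close>
    define k where "k = Suc i mod t"
    have k: "k < t" "k \<noteq> i"
      using t_ge_3 i(1) by (auto simp: k_def mod_Suc)
    define c' where "c' = c(i := c i - q, k := c k + 1)"
    have split: "(\<Sum>i<t. f i) = f i + (f k + (\<Sum>j\<in>{..<t} - {i} - {k}. f j))" for f :: "nat \<Rightarrow> nat"
      using i(1) k by (simp add: sum.remove)
    have rest: "(\<Sum>j\<in>{..<t} - {i} - {k}. c' j * f j) = (\<Sum>j\<in>{..<t} - {i} - {k}. c j * f j)"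
      for f :: "nat \<Rightarrow> nat"
      by (rule sum.cong) (auto simp: c'_def)
    \<comment> \<open>Arbitrary weights \<open>f\<close> cover both uses: weight 1 counts the
      summands, weight \<open>q ^ j\<close> gives the exponent.\<close>
    have exch: "(\<Sum>j<t. c' j * f j) + q * f i = (\<Sum>j<t. c j * f j) + f k" for f :: "nat \<Rightarrow> nat"
    proof -
      have "(c i - q) * f i + q * f i = c i * f i"
        using i(2) by (simp flip: add_mult_distrib)
      then show ?thesis
        using k(2) unfolding split[of "\<lambda>j. c' j * f j"] split[of "\<lambda>j. c j * f j"] rest
        by (simp add: c'_def)
    qed
    have less': "(\<Sum>j<t. c' j) < (\<Sum>j<t. c j)"
      using exch[of "\<lambda>_. 1"] q_ge_2 by simp
    have pow: "x ^ (\<Sum>j<t. c' j * q ^ j) = x ^ (\<Sum>i\<in>S. q ^ i)" if "x \<noteq> 0" for x :: 'a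
    proof -
      have "x ^ (\<Sum>j<t. c' j * q ^ j) * x ^ (q ^ Suc i) = x ^ (\<Sum>j<t. c j * q ^ j) * x ^ (q ^ k)"
        using exch[of "\<lambda>j. q ^ j"] by (simp flip: power_add)
      then show ?thesis
        using less.prems(2)[OF that] that by (simp add: k_def frob_mod)
    qed
    have "c' j = ?e j" if "j < t" for j
      by (rule less.hyps[OF less' _ pow that]) (use less' less.prems(1) in auto)
    \<comment> \<open>After the carry there are fewer than \<open>card S\<close> summands, yet by
      induction they are exactly those of \<open>S\<close>: a contradiction, so no digit reaches
      \<open>q\<close>.\<close>
    then have "(\<Sum>j<t. c' j) = (\<Sum>j<t. ?e j * 1)"
      by simp
    also have "\<dots> = card S"
      using sum_S[of "\<lambda>_. 1"] by simp
    finally show ?thesis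
      using less' less.prems(1) by simp
  next
    case False
    then have digit: "c i < q" if "i < t" for i
      using that by (meson not_le)
    let ?E = "\<Sum>i<t. c i * q ^ i" and ?E' = "\<Sum>i\<in>S. q ^ i"
    have E: "?E < q ^ t"
      by (rule sum_digits_less) (rule digit)
    \<comment> \<open>A missing position keeps \<open>?E'\<close> below \<open>q ^ t - 1\<close>, an
      exponent that cannot be told apart from 0 on nonzero elements.\<close>
    obtain j where j: "j < t" "j \<notin> S"
      using assms(1) by auto
    have "(\<Sum>i\<in>insert j S. q ^ i) = (\<Sum>i<t. (if i \<in> insert j S then 1 else 0) * q ^ i)"
      by (rule sym, rule trans[OF sum.mono_neutral_right[of _ "insert j S"]])
        (use assms(1) j in auto)
    also have "\<dots> < q ^ t"
      by (rule sum_digits_less) (use q_ge_2 in auto)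
    finally have "q ^ j + ?E' < q ^ t"
      using j finS by simp
    moreover have "1 \<le> q ^ j"
      using q_ge_2 by simp
    ultimately have E': "?E' + 1 < q ^ t"
      by linarith
    have "?E = ?E'"
    proof (rule ccontr)
      assume neq: "?E \<noteq> ?E'"
      define e where "e = (if ?E < ?E' then ?E' - ?E else ?E - ?E')"
      have one: "x ^ e = 1" if "x \<noteq> 0" for x :: 'a
        using less.prems(2)[OF that] that neq by (auto simp: e_def power_diff)
      have "0 < e"
        using neq by (auto simp: e_def)
      then have "CARD('a) - 1 \<le> e"
        using ex_power_neq_1[of e, where 'a = 'a] one not_le by blast
      \<comment> \<open>Exponents below \<open>q ^ t\<close> can differ by \<open>q ^ t - 1\<close>
        only if one of them is 0. This must be \<open>?E'\<close>, and the bound by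
        \<open>card S\<close> then leaves no summand for \<open>?E\<close> either.\<close>
      then have "?E' = 0"
        using E E' by (auto simp: e_def card_a split: if_splits)
      then have "S = {}"
        using q_ge_2 finS by (auto simp: sum_eq_0_iff)
      then have "?E = 0"
        using less.prems(1) by simp
      then show False
        using neq \<open>?E' = 0\<close> by simp
    qed
    then show ?thesis
      using digits_unique[of t c q ?e, OF digit _ _ less.prems(3)] q_ge_2
        sum_S[of "\<lambda>i. q ^ i"] by simp
  qed
qed

end

section \<open>Linearized polynomials with the ratios of the Frobenius map\<close>

text \<open>A shortest cycle has no chords, so from each of its vertices exactly one arc stays
  inside the vertex set; this is the uniqueness of \<open>f\<close>. If the cycle omits a residue,
  its vertex set is the required \<open>S\<close>. If even a shortest cycle passes through all
  \<open>t\<close> residues, then repeating one step \<open>s\<close> cannot close up early, so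
  \<open>s\<close> is coprime to \<open>t\<close>, and a second step would provide a
  shortcut.\<close>

lemma circulant_shortest_cycle:
  fixes T :: "nat set"
  assumes T: "T \<subseteq> {..<t}" "T \<noteq> {}"
  shows "(\<exists>s. coprime s t \<and> T = {s}) \<or>
    (\<exists>S f. S \<noteq> {} \<and> S \<subset> {..<t} \<and> f \<in> S \<rightarrow>\<^sub>E T \<and> bij_betw (\<lambda>i. (i + f i) mod t) S S
      \<and> (\<forall>h \<in> S \<rightarrow>\<^sub>E T. (\<lambda>i. (i + h i) mod t) ` S \<subseteq> S \<longrightarrow> h = f))"
proof -
  define E where "E = {(x, (x + j) mod t) | x j. x < t \<and> j \<in> T}"
  have t: "0 < t"
    using T by (cases t) auto
  have step: "(x, (x + j) mod t) \<in> E" if "x < t" "j \<in> T" for x j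
    using that by (auto simp: E_def)
  have target_unique: "i = j" if "(x + i) mod t = (x + j) mod t" "i \<in> T" "j \<in> T" for x i j
  proof -
    have "[i = j] (mod t)"
      using that(1) by (metis cong_add_lcancel_nat unique_euclidean_semiring_class.cong_def)
    then show ?thesis
      using that(2,3) T(1) cong_less_modulus_unique_nat by blast
  qed
  have iter: "(x, (x + n * s) mod t) \<in> E ^^ n" if "x < t" "s \<in> T" for x n s
  proof (induction n)
    case (Suc n)
    have "((x + n * s) mod t, ((x + n * s) mod t + s) mod t) \<in> E"
      using t that(2) by (intro step) auto
    moreover have "((x + n * s) mod t + s) mod t = (x + Suc n * s) mod t"
      by (simp add: mod_simps algebra_simps)
    ultimately show ?case
      using Suc by (metis relpow_Suc_I)
  qed (use that in simp)
  \<comment> \<open>Closed walks are easier to compose than cycles; minimality of the length makes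
    the vertices distinct.\<close>
  define cyc where "cyc n \<longleftrightarrow> 0 < n \<and> (\<exists>x. (x, x) \<in> E ^^ n)" for n
  obtain s where s: "s \<in> T"
    using T by blast
  have "cyc t"
    using iter[OF t s, of t] t by (auto simp: cyc_def)
  define r where "r = (LEAST n. cyc n)"
  have "cyc r"
    unfolding r_def by (rule LeastI) (rule \<open>cyc t\<close>)
  have min: "r \<le> n" if "cyc n" for n
    unfolding r_def by (rule Least_le) (rule that)
  have "0 < r" "r \<le> t"
    using \<open>cyc r\<close> min \<open>cyc t\<close> by (auto simp: cyc_def)
  obtain p where p: "p 0 = p r" "\<And>i. i < r \<Longrightarrow> (p i, p (Suc i)) \<in> E"
    using \<open>cyc r\<close> unfolding cyc_def relpow_fun_conv by metis
  have p_less: "p i < t" if "i < r" for i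
    using p(2)[OF that] by (auto simp: E_def)
  have path: "(p i, p j) \<in> E ^^ (j - i)" if "i \<le> j" "j \<le> r" for i j
    unfolding relpow_fun_conv by (rule exI[of _ "\<lambda>k. p (i + k)"]) (use that p in auto)
  have "p i \<noteq> p j" if "i < j" "j < r" for i j
  proof
    assume "p i = p j"
    then have "cyc (j - i)"
      using path[of i j] that by (auto simp: cyc_def)
    then show False
      using min[of "j - i"] that by simp
  qed
  then have inj: "inj_on p {..<r}"
    by (auto simp: inj_on_def) (metis linorder_neqE_nat)
  \<comment> \<open>Absence of chords. A backward arc closes a walk of length
    \<open>i - j + 1\<close>, which is too short unless it runs from the last vertex to the first. A
    forward arc skips \<open>j - i - 1\<close> vertices and so shortens the cycle unless
    \<open>j = Suc i\<close>.\<close>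
  have succ: "p j = p (Suc i)" if ij: "i < r" "j < r" "(p i, p j) \<in> E" for i j
  proof (cases "j \<le> i")
    case True
    then have "cyc (Suc (i - j))"
      using path[of j i] ij by (auto simp: cyc_def intro: relpow_Suc_I)
    then have "Suc i = r" "j = 0"
      using min[of "Suc (i - j)"] ij True by auto
    then show ?thesis
      using p(1) by simp
  next
    case False
    have "(p j, p i) \<in> E ^^ (r - j + i)"
      using path[of j r] path[of 0 i] p(1) ij unfolding relpow_add by auto
    then have "cyc (Suc (r - j + i))"
      using ij by (auto simp: cyc_def intro: relpow_Suc_I)
    then have "r \<le> Suc (r - j + i)"
      by (rule min)
    then have "j = Suc i"
      using False ij by auto
    then show ?thesis by simp
  qed
  show ?thesis
  proof (cases "r < t")
    case True
    define S where "S = p ` {..<r}"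
    have "card S = r"
      using inj by (simp add: S_def card_image)
    have S: "S \<noteq> {}" "S \<subset> {..<t}"
      using \<open>0 < r\<close> p_less True \<open>card S = r\<close> by (auto simp: S_def)
    have "\<forall>x\<in>S. \<exists>d. d \<in> T \<and> (\<exists>i<r. x = p i \<and> p (Suc i) = (x + d) mod t)"
      using p(2) by (fastforce simp: S_def E_def)
    then obtain f0 where f0: "\<And>x. x \<in> S \<Longrightarrow> f0 x \<in> T"
        "\<And>x. x \<in> S \<Longrightarrow> \<exists>i<r. x = p i \<and> p (Suc i) = (x + f0 x) mod t"
      by metis
    \<comment> \<open>Restriction makes \<open>f\<close> extensional, so that it is one of the
      choice functions indexing an expanded product over \<open>S\<close>.\<close>
    define f where "f = restrict f0 S"
    have f: "f \<in> S \<rightarrow>\<^sub>E T"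
      using f0(1) by (auto simp: f_def)
    have next_p: "(p i + f (p i)) mod t = p (Suc i)" if "i < r" for i
    proof -
      have "p i \<in> S"
        using that by (auto simp: S_def)
      moreover obtain i' where i': "i' < r" "p i = p i'" "p (Suc i') = (p i + f0 (p i)) mod t"
        using f0(2)[OF \<open>p i \<in> S\<close>] by blast
      moreover have "i = i'"
        using inj_onD[OF inj i'(2)] i'(1) that by blast
      ultimately show ?thesis
        by (simp add: f_def)
    qed
    have surj: "(\<lambda>i. (i + f i) mod t) ` S = S"
    proof -
      have "(\<lambda>i. (i + f i) mod t) ` S = (\<lambda>i. p (Suc i)) ` {..<r}"
        unfolding S_def image_image by (rule image_cong) (use next_p in auto)
      also have "\<dots> = S"
      proof (rule equalityI; rule subsetI)
        fix y assume "y \<in> (\<lambda>i. p (Suc i)) ` {..<r}"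
        then obtain i where i: "i < r" "y = p (Suc i)"
          by auto
        then have "y = p (if Suc i = r then 0 else Suc i)"
          using p(1) by auto
        then show "y \<in> S"
          using i \<open>0 < r\<close> by (auto simp: S_def split: if_splits)
      next
        fix y assume "y \<in> S"
        then obtain i where i: "i < r" "y = p i"
          by (auto simp: S_def)
        then have "y = p (Suc (if i = 0 then r - 1 else i - 1))"
          using p(1) \<open>0 < r\<close> by auto
        then show "y \<in> (\<lambda>i. p (Suc i)) ` {..<r}"
          by (rule image_eqI) (use i(1) in auto)
      qed
      finally show ?thesis .
    qed
    moreover have "inj_on (\<lambda>i. (i + f i) mod t) S"
      by (rule finite_surj_inj) (use surj in \<open>auto simp: S_def\<close>)
    ultimately have bij: "bij_betw (\<lambda>i. (i + f i) mod t) S S"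
      by (simp add: bij_betw_def)
    have "h = f" if h: "h \<in> S \<rightarrow>\<^sub>E T" "(\<lambda>i. (i + h i) mod t) ` S \<subseteq> S" for h
    proof (rule PiE_ext[OF h(1) f])
      fix x assume x: "x \<in> S"
      then obtain i where i: "i < r" "x = p i"
        by (auto simp: S_def)
      have "(x + h x) mod t \<in> S"
        using h(2) x by auto
      then obtain j where j: "j < r" "(x + h x) mod t = p j"
        by (auto simp: S_def)
      have "(x, (x + h x) mod t) \<in> E"
        using h(1) x S by (intro step) auto
      then have "p j = p (Suc i)"
        using i j by (intro succ) auto
      then have "(x + h x) mod t = (x + f x) mod t"
        using next_p[OF i(1)] i(2) j(2) by argo
      then show "h x = f x"
        by (rule target_unique[OF _ PiE_mem[OF h(1) x] PiE_mem[OF f x]])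
    qed
    then show ?thesis
      using S f bij by (intro disjI2 exI[of _ S] exI[of _ f] conjI ballI impI)
  next
    case False
    then have "r = t"
      using \<open>r \<le> t\<close> by simp
    have "coprime s t"
    proof -
      \<comment> \<open>\<open>d\<close> is the order of \<open>s\<close> modulo \<open>t\<close>,
        the length of the closed walk that always takes step \<open>s\<close>.\<close>
      define d where "d = t div gcd s t"
      have d: "0 < d" "d * gcd s t = t"
        using t by (auto simp: d_def div_greater_zero_iff dvd_imp_le)
      have "t dvd d * s"
        by (metis d(2) gcd_dvd1 mult_dvd_mono dvd_refl)
      then have "cyc d"
        using iter[OF t s, of d] d(1) by (auto simp: cyc_def)
      then have "t \<le> d"
        using min \<open>r = t\<close> by blast
      then have "d * gcd s t \<le> d * 1"
        using d(2) by linarith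
      then have "gcd s t \<le> 1"
        using d(1) by simp
      moreover have "0 < gcd s t"
        using t by simp
      ultimately have "gcd s t = 1"
        by linarith
      then show ?thesis
        by (simp add: coprime_iff_gcd_eq_1)
    qed
    have "s' = s" if s': "s' \<in> T" for s'
    proof (rule ccontr)
      assume neq: "s' \<noteq> s"
      have lt: "s < t" "s' < t"
        using s s' T by auto
      obtain x where x: "[s * x = 1] (mod t)"
        using cong_solve_coprime_nat[OF \<open>coprime s t\<close>] by auto
      \<comment> \<open>\<open>k\<close> steps \<open>s\<close> have the effect of one step
        \<open>s'\<close>. Hence \<open>t - k\<close> steps \<open>s\<close> lead from
        \<open>s'\<close> to 0 and one step \<open>s'\<close> leads back, a closed walk of length
        \<open>t - k + 1\<close>. Minimality leaves \<open>k = 1\<close>, which means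
        \<open>s' = s\<close>, and \<open>k = 0\<close>, which gives a loop at 0.\<close>
      define k where "k = (x * s') mod t"
      have k: "k < t"
        using t by (simp add: k_def)
      have "[k * s = s'] (mod t)"
        using cong_scalar_right[OF x, of s']
        by (simp add: k_def unique_euclidean_semiring_class.cong_def mod_simps ac_simps)
      then have ks: "k * s mod t = s'"
        using lt by (simp add: unique_euclidean_semiring_class.cong_def)
      have "k \<noteq> 1"
        using ks neq lt by auto
      have "(s', (s' + (t - k) * s) mod t) \<in> E ^^ (t - k)"
        using lt s by (intro iter)
      moreover have "(s' + (t - k) * s) mod t = 0"
      proof -
        have "(s' + (t - k) * s) mod t = (k * s + (t - k) * s) mod t"
          using ks by (metis mod_add_left_eq)
        also have "k * s + (t - k) * s = t * s"
          using k by (simp flip: add_mult_distrib)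
        finally show ?thesis by simp
      qed
      moreover have "(0, s') \<in> E"
        using step[OF t s'] lt by simp
      ultimately have "(s', s') \<in> E ^^ Suc (t - k)"
        by (metis relpow_Suc_I)
      then have "cyc (Suc (t - k))"
        by (auto simp: cyc_def)
      then have "k = 0"
        using min \<open>r = t\<close> \<open>k \<noteq> 1\<close> k by fastforce
      then have "s' = 0"
        using ks by simp
      then have "(0, 0) \<in> E ^^ 1"
        using step[OF t s'] by simp
      then have "cyc 1"
        unfolding cyc_def by blast
      then have "t \<le> 1"
        using min \<open>r = t\<close> by blast
      then show False
        using lt neq by simp
    qed
    then have "T = {s}"
      using s by blast
    then show ?thesis
      using \<open>coprime s t\<close> by blast
  qed
qed

context finite_field_extension
begin

text \<open>
  If the polynomial has more than one term, let \<open>S\<close> be the vertex set of a shortest cycle in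
  the digraph on the residues modulo \<open>t\<close> with arcs \<open>i \<rightarrow> i + j\<close> for \<open>c j \<noteq> 0\<close>. Expanding the
  power sum of the values with exponent \<open>\<Sum>i\<in>S. q ^ i\<close>, only the term that belongs to the cycle
  itself survives, while the corresponding power sum for \<open>x\<^sup>q / x\<close> vanishes.
\<close>

lemma linearized_ratio_set_eq_imp_monomial:
  fixes c :: "nat \<Rightarrow> 'a"
  assumes ratio: "(\<lambda>x. (\<Sum>j<t. c j * x ^ (q ^ j)) / x) ` (UNIV - {0}) = (\<lambda>x. x ^ q / x) ` (UNIV - {0})"
  shows "\<exists>s<t. coprime s t \<and> c s \<noteq> 0 \<and> (\<forall>j<t. j \<noteq> s \<longrightarrow> c j = 0)"
proof -
  define g where "g x = (\<Sum>j<t. c j * x ^ (q ^ j))" for x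
  define T where "T = {j. j < t \<and> c j \<noteq> 0}"
  have T: "T \<noteq> {}"
  proof
    assume "T = {}"
    then have "g 1 / 1 = 0"
      by (auto simp: g_def T_def)
    moreover have "g 1 / 1 \<in> (\<lambda>x. g x / x) ` (UNIV - {0})"
      by (rule imageI) simp
    then have "g 1 / 1 \<in> (\<lambda>x. x ^ q / x) ` (UNIV - {0})"
      using ratio by (simp only: g_def)
    ultimately show False
      by auto
  qed
  have "T \<subseteq> {..<t}"
    by (auto simp: T_def)
  from circulant_shortest_cycle[OF this T] show ?thesis
  proof (elim disjE exE conjE)
    fix s assume "coprime s t" "T = {s}"
    then have "c j \<noteq> 0 \<longleftrightarrow> j = s" if "j < t" for j
      using that by (auto simp: T_def)
    moreover have "s < t"
      using \<open>T = {s}\<close> by (auto simp: T_def)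
    ultimately show ?thesis
      using \<open>coprime s t\<close> by blast
  next
    fix S f
    assume cycle: "S \<noteq> {}" "S \<subset> {..<t}" "f \<in> S \<rightarrow>\<^sub>E T" "bij_betw (\<lambda>i. (i + f i) mod t) S S"
      "\<forall>h \<in> S \<rightarrow>\<^sub>E T. (\<lambda>i. (i + h i) mod t) ` S \<subseteq> S \<longrightarrow> h = f"
    have finS: "finite S"
      using cycle(2) finite_subset by auto
    define d where "d = (\<Sum>i\<in>S. q ^ i)"
    obtain p where p: "q = Suc p" "0 < p"
      using q_ge_2 by (cases q) auto
    \<comment> \<open>As \<open>S\<close> is a nonempty proper subset, this geometric sum places
      \<open>(q - 1) * d\<close> strictly between 0 and \<open>q ^ t - 1\<close>, so some nonzero
      \<open>y\<close> has \<open>y ^ ((q - 1) * d)\<close> different from 1.\<close>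
    have "p * (\<Sum>i<n. q ^ i) + 1 = q ^ n" for n
      unfolding p(1) by (induction n) (auto simp: algebra_simps)
    then have "p * (\<Sum>i<t. q ^ i) + 1 = q ^ t" .
    moreover have "d < (\<Sum>i<t. q ^ i)"
      unfolding d_def using cycle(2) q_ge_2 by (auto intro!: sum_strict_mono2)
    then have "p * d < p * (\<Sum>i<t. q ^ i)"
      using p(2) by simp
    ultimately have "(q - 1) * d < q ^ t - 1"
      using p(1) by (metis add_diff_cancel_right' diff_Suc_1)
    moreover have "0 < (q - 1) * d"
      using cycle(1) finS q_ge_2 by (auto simp: d_def sum_eq_0_iff intro!: Nat.gr0I)
    ultimately obtain y :: 'a where y: "y \<noteq> 0" "y ^ ((q - 1) * d) \<noteq> 1"
      using ex_power_neq_1[of "(q - 1) * d", where 'a = 'a] by (auto simp: card_a)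
    have "(\<Sum>x\<in>UNIV - {0}. (x ^ q / x) ^ d) = (0::'a)"
    proof (rule sum_nonzero_eq_0_if_scales[OF y])
      fix x :: 'a assume "x \<noteq> 0"
      have "y ^ ((q - 1) * d) = (y ^ q / y) ^ d"
        using y(1) q_ge_2 by (simp add: power_mult power_diff)
      moreover have "(y * x) ^ q / (y * x) = (y ^ q / y) * (x ^ q / x)"
        by (simp add: power_mult_distrib)
      ultimately show "((y * x) ^ q / (y * x)) ^ d = y ^ ((q - 1) * d) * (x ^ q / x) ^ d"
        by (simp only: power_mult_distrib)
    qed
    moreover have "(\<Sum>x\<in>UNIV - {0}. (x ^ q / x) ^ d) = (\<Sum>x\<in>UNIV - {0}. (g x / x) ^ d)"
    proof -
      have "g (x + y) = g x + g y" for x y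
        by (simp add: g_def frob_add distrib_left sum.distrib)
      note sum_ratio_additive[of g "\<lambda>m. m ^ d", OF this]
        sum_ratio_additive[of "\<lambda>x::'a. x ^ q" "\<lambda>m. m ^ d", OF power_q_add]
      moreover have "(\<lambda>x. g x / x) ` (UNIV - {0}) = (\<lambda>x. x ^ q / x) ` (UNIV - {0})"
        using ratio by (simp only: g_def)
      ultimately show ?thesis
        by (simp only:)
    qed
    moreover define A where "A h = (\<Prod>i\<in>S. c (h i) ^ (q ^ i))" for h
    define e where "e h = (\<Sum>i\<in>S. q ^ ((i + h i) mod t))" for h
    \<comment> \<open>Since \<open>d\<close> is a sum of powers of \<open>q\<close>, the left side
      is a product of Frobenius images of \<open>g x / x\<close>, each still linearized in
      \<open>x\<close>. Multiplying out, \<open>h\<close> chooses one summand from every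
      factor.\<close>
    have "(g x / x) ^ d = (\<Sum>h\<in>S \<rightarrow>\<^sub>E {..<t}. A h * (x ^ e h / x ^ d))" for x
    proof -
      have "(g x / x) ^ d = (\<Prod>i\<in>S. (\<Sum>j<t. c j ^ (q ^ i) * x ^ (q ^ ((i + j) mod t)) / x ^ (q ^ i)))"
        by (simp add: d_def power_sum power_divide g_def frob_sum power_mult_distrib frob_compose
            sum_divide_distrib add.commute)
      also have "\<dots> = (\<Sum>h\<in>S \<rightarrow>\<^sub>E {..<t}. \<Prod>i\<in>S. c (h i) ^ (q ^ i) * x ^ (q ^ ((i + h i) mod t)) / x ^ (q ^ i))"
        by (rule prod_sum_PiE) (use finS in auto)
      also have "\<dots> = (\<Sum>h\<in>S \<rightarrow>\<^sub>E {..<t}. A h * (x ^ e h / x ^ d))"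
        by (simp add: A_def e_def d_def power_sum prod.distrib prod_dividef)
      finally show ?thesis .
    qed
    ultimately have "0 = (\<Sum>x\<in>UNIV - {0}. \<Sum>h\<in>S \<rightarrow>\<^sub>E {..<t}. A h * (x ^ e h / x ^ d))"
      by simp
    also have "\<dots> = (\<Sum>h\<in>S \<rightarrow>\<^sub>E {..<t}. A h * (\<Sum>x\<in>UNIV - {0}. x ^ e h / x ^ d))"
      unfolding sum_distrib_left by (rule sum.swap)
    also have "\<dots> = (\<Sum>h\<in>{f}. A h * (\<Sum>x\<in>UNIV - {0}. x ^ e h / x ^ d))"
    proof (rule sum.mono_neutral_right)
      show "finite (S \<rightarrow>\<^sub>E {..<t})"
        using finS by (simp add: finite_PiE)
      show "{f} \<subseteq> S \<rightarrow>\<^sub>E {..<t}"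
        using cycle(3) by (auto simp: T_def PiE_iff)
      show "\<forall>h\<in>(S \<rightarrow>\<^sub>E {..<t}) - {f}. A h * (\<Sum>x\<in>UNIV - {0}. x ^ e h / x ^ d) = 0"
      proof
        fix h assume h: "h \<in> (S \<rightarrow>\<^sub>E {..<t}) - {f}"
        show "A h * (\<Sum>x\<in>UNIV - {0}. x ^ e h / x ^ d) = 0"
        proof (cases "A h = 0")
          case False
          define \<tau> where "\<tau> i = (i + h i) mod t" for i
          have \<tau>_less: "\<tau> i < t" for i
            using t_ge_3 by (simp add: \<tau>_def)
          have "h \<in> S \<rightarrow>\<^sub>E T"
            using h False finS q_ge_2 by (auto simp: T_def A_def PiE_iff)
          then have not_into: "\<not> \<tau> ` S \<subseteq> S"
            using cycle(5) h by (auto simp: \<tau>_def)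
          have "\<exists>y::'a. y \<noteq> 0 \<and> y ^ e h \<noteq> y ^ d"
          proof (rule ccontr)
            assume "\<not> ?thesis"
            then have pow: "\<And>y::'a. y \<noteq> 0 \<Longrightarrow> y ^ e h = y ^ d"
              by blast
            \<comment> \<open>\<open>m j\<close> is the multiplicity of \<open>q ^ j\<close> among
              the \<open>card S\<close> summands of \<open>e h\<close>. If \<open>e h\<close> and
              \<open>d\<close> acted alike, uniqueness of the shortest expansion would put every
              \<open>\<tau> i\<close> into \<open>S\<close>, against the uniqueness of the
              cycle.\<close>
            define m where "m j = card {i \<in> S. \<tau> i = j}" for j
            have sum_m: "(\<Sum>j<t. m j * F j) = (\<Sum>i\<in>S. F (\<tau> i))" for F :: "nat \<Rightarrow> nat"
            proof -
              have "(\<Sum>j<t. m j * F j) = (\<Sum>j<t. \<Sum>i\<in>{i \<in> S. \<tau> i = j}. F (\<tau> i))"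
                by (simp add: m_def)
              also have "\<dots> = (\<Sum>i\<in>S. F (\<tau> i))"
                by (rule sum.group) (use finS \<tau>_less in auto)
              finally show ?thesis .
            qed
            have m: "m j = (if j \<in> S then 1 else 0)" if "j < t" for j
            proof (rule minimal_expansion_unique[OF cycle(2) _ _ that])
              show "(\<Sum>i<t. m i) \<le> card S"
                using sum_m[of "\<lambda>_. 1"] by simp
              show "x ^ (\<Sum>i<t. m i * q ^ i) = x ^ (\<Sum>i\<in>S. q ^ i)" if "x \<noteq> 0" for x :: 'a
                using pow[OF that] sum_m[of "\<lambda>i. q ^ i"] by (simp add: e_def d_def \<tau>_def)
            qed
            obtain i where i: "i \<in> S" "\<tau> i \<notin> S"
              using not_into by blast
            then have "{i' \<in> S. \<tau> i' = \<tau> i} = {}"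
              using m[OF \<tau>_less, of i] finS by (simp add: m_def)
            then show False
              using i by blast
          qed
          then obtain y :: 'a where y: "y \<noteq> 0" "y ^ e h \<noteq> y ^ d"
            by blast
          have "(\<Sum>x\<in>UNIV - {0}. x ^ e h / x ^ d) = (0::'a)"
            by (rule sum_nonzero_eq_0_if_scales[of y "y ^ e h / y ^ d"])
              (use y in \<open>auto simp: power_mult_distrib\<close>)
          then show ?thesis by simp
        qed simp
      qed
    qed
    also have "\<dots> = A f * (\<Sum>x\<in>UNIV - {0::'a}. 1)"
    proof -
      have "e f = d"
        unfolding e_def d_def by (rule sum.reindex_bij_betw[OF cycle(4)])
      then show ?thesis by simp
    qed
    \<comment> \<open>The size of the whole field is 0 in the field. What remains of the power sum
      is \<open>- A f\<close>, although \<open>A f\<close> has only nonzero factors.\<close>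
    also have "(\<Sum>x\<in>UNIV - {0::'a}. 1) = (- 1 :: 'a)"
      using of_nat_card_eq_0_if_add_closed[of UNIV "1::'a"]
      by (simp add: card_Diff_singleton of_nat_diff Suc_leI)
    finally have "A f = 0"
      by simp
    then show ?thesis
      using cycle(3) finS by (auto simp: A_def T_def PiE_iff)
  qed
qed

end

section \<open>Points and forms over the subfield\<close>

text \<open>Adjoining an independent vector multiplies the size by \<open>CARD('k)\<close>.
  Dimensions over the small field can thus be replaced by cardinalities.\<close>

lemma card_subspace_finite_field:
  fixes scale :: "'k::{field,finite} \<Rightarrow> 'b::{ab_group_add,finite} \<Rightarrow> 'b"
  assumes "vector_space scale" "module.subspace scale U"
  shows "card U = CARD('k) ^ vector_space.dim scale U"
proof -
  interpret vector_space scale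
    by fact
  have "card (span B) = CARD('k) ^ card B" if "independent B" for B
    using finite[of B] that
  proof (induction B rule: finite_induct)
    case (insert b B)
    then have b: "b \<notin> span B" "independent B"
      by (auto simp: independent_insert)
    have "inj_on (\<lambda>(c, x). scale c b + x) (UNIV \<times> span B)"
    proof (rule inj_onI, clarify)
      fix c c' x x'
      assume x: "x \<in> span B" "x' \<in> span B" and eq: "scale c b + x = scale c' b + x'"
      have "scale (c - c') b = x' - x"
        using eq by (simp add: algebra_simps)
      then have "scale (c - c') b \<in> span B"
        using x by (simp add: span_diff)
      then have "c = c'"
        using b(1) span_scale[of "scale (c - c') b" B "inverse (c - c')"] by (cases "c = c'") auto
      then show "c = c' \<and> x = x'"
        using eq by simp
    qed
    moreover have "span (insert b B) = (\<lambda>(c, x). scale c b + x) ` (UNIV \<times> span B)"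
    proof (intro equalityI subsetI)
      fix y assume "y \<in> span (insert b B)"
      then obtain k where "y - scale k b \<in> span B"
        by (auto simp: span_insert)
      then show "y \<in> (\<lambda>(c, x). scale c b + x) ` (UNIV \<times> span B)"
        by (intro image_eqI[of _ _ "(k, y - scale k b)"]) auto
    next
      fix y assume "y \<in> (\<lambda>(c, x). scale c b + x) ` (UNIV \<times> span B)"
      then obtain k x where "y = scale k b + x" "x \<in> span B"
        by auto
      then show "y \<in> span (insert b B)"
        unfolding span_insert by (auto intro!: exI[of _ k])
    qed
    ultimately show ?case
      using insert b by (simp add: card_image card_cartesian_product)
  qed (simp add: span_empty)
  moreover obtain B where "B \<subseteq> U" "independent B" "U \<subseteq> span B" "card B = dim U"
    using basis_exists by blast
  moreover have "span B = U"
    using calculation assms(2) by (simp add: span_minimal subset_antisym)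
  ultimately show ?thesis
    by metis
qed

lemma span_singleton_scale:
  fixes x :: "'a::field ^ 'n"
  shows "c \<noteq> 0 \<Longrightarrow> vec.span {c *s x} = vec.span {x}"
  using vec.span_image_scale[of "{x}" "\<lambda>_. c"] by simp

lemma span_singleton_eq_iff:
  fixes x y :: "'a::field ^ 'n"
  assumes "x \<noteq> 0"
  shows "vec.span {x} = vec.span {y} \<longleftrightarrow> (\<exists>c. c \<noteq> 0 \<and> y = c *s x)"
proof
  assume eq: "vec.span {x} = vec.span {y}"
  obtain c where c: "y = c *s x"
    using eq vec.span_base[of y "{y}"] by (auto simp: vec.span_singleton)
  moreover have "c \<noteq> 0"
    using eq vec.span_base[of x "{x}"] assms by (auto simp: c)
  ultimately show "\<exists>c. c \<noteq> 0 \<and> y = c *s x"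
    by blast
qed (auto simp: span_singleton_scale)

lemma span_singleton_in_PG_iff:
  fixes x :: "'a::field ^ 'n"
  assumes "vec.subspace K" "x \<noteq> 0"
  shows "vec.span {x} \<in> PG K \<longleftrightarrow> x \<in> K"
proof
  assume "vec.span {x} \<in> PG K"
  then obtain y where "y \<in> K" "vec.span {x} = vec.span {y}"
    by (auto simp: PG_def)
  then have "x \<in> vec.span {y}" "vec.span {y} \<subseteq> K"
    using vec.span_base[of x "{x}"] vec.span_minimal[of "{y}" K] assms(1) by auto
  then show "x \<in> K"
    by blast
qed (use assms in \<open>auto simp: PG_def\<close>)

lemma PG_Int:
  fixes K L :: "('a::field ^ 'n) set"
  assumes "vec.subspace K" "vec.subspace L"
  shows "PG K \<inter> PG L = PG (K \<inter> L)"
proof (intro equalityI subsetI)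
  fix P assume P: "P \<in> PG K \<inter> PG L"
  then obtain x where "P = vec.span {x}" "x \<in> K" "x \<noteq> 0"
    by (auto simp: PG_def)
  then show "P \<in> PG (K \<inter> L)"
    using P span_singleton_in_PG_iff[OF assms(2)] by (auto simp: PG_def)
qed (auto simp: PG_def)

lemma PG_subset_iff:
  fixes K L :: "('a::field ^ 'n) set"
  assumes "vec.subspace K" "vec.subspace L"
  shows "PG K \<subseteq> PG L \<longleftrightarrow> K \<subseteq> L"
proof
  assume sub: "PG K \<subseteq> PG L"
  show "K \<subseteq> L"
  proof
    fix x assume "x \<in> K"
    then show "x \<in> L"
      using sub assms span_singleton_in_PG_iff[of K x] span_singleton_in_PG_iff[of L x]
      by (cases "x = 0") (auto simp: vec.subspace_0)
  qed
qed (auto simp: PG_def)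

lemma PG_span_singleton:
  fixes x :: "'a::field ^ 'n"
  assumes "x \<noteq> 0"
  shows "PG (vec.span {x}) = {vec.span {x}}"
proof (intro equalityI subsetI)
  fix P assume "P \<in> PG (vec.span {x})"
  then obtain c where "P = vec.span {c *s x}" "c *s x \<noteq> 0"
    by (auto simp: PG_def vec.span_singleton)
  then show "P \<in> {vec.span {x}}"
    using span_singleton_scale[of c x] by auto
next
  fix P assume "P \<in> {vec.span {x}}"
  then show "P \<in> PG (vec.span {x})"
    using assms vec.span_base[of x "{x}"] by (auto simp: PG_def)
qed

lemma span_Union_PG: "vec.span (\<Union> (PG U)) = vec.span U"
proof (intro equalityI vec.span_minimal)
  show "\<Union> (PG U) \<subseteq> vec.span U"
    by (auto simp: PG_def dest: subsetD[OF vec.span_mono, rotated])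
  show "U \<subseteq> vec.span (\<Union> (PG U))"
  proof
    fix x assume "x \<in> U"
    then show "x \<in> vec.span (\<Union> (PG U))"
      by (cases "x = 0") (auto simp: PG_def vec.span_zero intro!: vec.span_base vec.span_superset
          exI[of _ "vec.span {x}"])
  qed
qed (rule vec.subspace_span)+

section \<open>Coordinates adapted to the subgeometry\<close>

locale canonical_frame = finite_field_extension emb q t
  for emb :: "'k::{field,finite} \<Rightarrow> 'a::{field,finite}" and q t :: nat +
  fixes A :: "'a ^ 'n \<Rightarrow> 'a ^ 'n" and W :: "('a ^ 'n) set"
  assumes card_n: "CARD('n) = t"
    and linear_A: "Vector_Spaces.linear (*s) (*s) A" and bij_A: "bij A"
    and W_eq: "W = range (\<lambda>a. A (\<chi> i. emb (a $ i)))"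
begin

definition coord :: "'a ^ 'n \<Rightarrow> 'a ^ 'n" where
  "coord = inv_into UNIV A"

definition form :: "'k ^ 'n \<Rightarrow> 'a ^ 'n \<Rightarrow> 'a" where
  "form a x = (\<Sum>i\<in>UNIV. emb (a $ i) * coord x $ i)"

definition semilin :: "('a \<Rightarrow> 'a) \<Rightarrow> 'a ^ 'n \<Rightarrow> 'a ^ 'n" where
  "semilin \<theta> x = A (\<chi> i. \<theta> (coord x $ i))"

abbreviation Frob :: "nat \<Rightarrow> 'a ^ 'n \<Rightarrow> 'a ^ 'n" where
  "Frob s \<equiv> semilin (\<lambda>x. x ^ (q ^ s))"

lemma coord_A [simp]: "coord (A x) = x"
  using bij_A by (simp add: coord_def bij_is_inj)

lemma A_coord [simp]: "A (coord x) = x"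
  using bij_A by (simp add: coord_def bij_is_surj surj_f_inv_f)

lemma A_add: "A (x + y) = A x + A y" and A_scale: "A (c *s x) = c *s A x"
  using linear_A by (simp_all add: linear_iff_module_hom module_hom.add module_hom.scale)

lemma coord_add: "coord (x + y) = coord x + coord y"
  by (metis A_add A_coord coord_A)

lemma coord_scale: "coord (c *s x) = c *s coord x"
  by (metis A_scale A_coord coord_A)

lemma coord_eq_iff: "coord x = coord y \<longleftrightarrow> x = y"
  by (metis A_coord)

lemma coord_0 [simp]: "coord 0 = 0"
  using coord_scale[of 0 0] by simp

lemma form_add: "form a (x + y) = form a x + form a y"
  by (simp add: form_def coord_add algebra_simps sum.distrib)

lemma form_scale: "form a (c *s x) = c * form a x"
  by (simp add: form_def coord_scale sum_distrib_left ac_simps)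

lemma form_0 [simp]: "form a 0 = 0"
  by (simp add: form_def)

lemma form_minus: "form a (- x) = - form a x"
  using form_scale[of a "- 1" x] by simp

lemma form_diff: "form a (x - y) = form a x - form a y"
  using form_add[of a x "- y"] by (simp add: form_minus)

lemma form_sum: "form a (\<Sum>i\<in>I. f i) = (\<Sum>i\<in>I. form a (f i))"
  by (induction I rule: infinite_finite_induct) (auto simp: form_add)

lemma form_add_left: "form (a + b) x = form a x + form b x"
  by (simp add: form_def emb_add algebra_simps sum.distrib)

lemma form_diff_left: "form (a - b) x = form a x - form b x"
  by (simp add: form_def emb_diff algebra_simps sum_subtractf)

lemma form_scale_left: "form (k *s a) x = emb k * form a x"
  by (simp add: form_def emb_mult sum_distrib_left ac_simps)

lemma form_zero_left [simp]: "form 0 x = 0"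
  by (simp add: form_def)

lemma form_axis: "form (axis i 1) x = coord x $ i"
proof -
  have "emb (axis i 1 $ j) * coord x $ j = (if j = i then coord x $ j else 0)" for j
    by (simp add: axis_def)
  then show ?thesis
    by (simp add: form_def)
qed

lemma eq_if_forms_eq: "(\<And>a. form a x = form a y) \<Longrightarrow> x = y"
  by (metis coord_eq_iff form_axis vec_eq_iff)

lemma in_W_iff: "x \<in> W \<longleftrightarrow> (\<forall>i. coord x $ i \<in> range emb)"
proof
  assume "\<forall>i. coord x $ i \<in> range emb"
  then have "\<forall>i. \<exists>k. coord x $ i = emb k"
    by (simp add: image_iff)
  then obtain a where a: "\<forall>i. coord x $ i = emb (a i)"
    by (rule choice[THEN exE])
  have "coord x = (\<chi> i. emb ((\<chi> i. a i) $ i))"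
    using a by (simp add: vec_eq_iff)
  then have "x = A (\<chi> i. emb ((\<chi> i. a i) $ i))"
    using A_coord[of x] by simp
  then show "x \<in> W"
    unfolding W_eq by blast
qed (auto simp: W_eq)

lemma form_W: "x \<in> W \<Longrightarrow> form a x \<in> range emb"
proof -
  assume "x \<in> W"
  then obtain b where "x = A (\<chi> i. emb (b $ i))"
    by (auto simp: W_eq)
  then have "form a x = (\<Sum>i\<in>UNIV. emb (a $ i * b $ i))"
    by (simp add: form_def emb_mult)
  moreover have "(\<Sum>i\<in>I. emb (a $ i * b $ i)) = emb (\<Sum>i\<in>I. a $ i * b $ i)" for I
    by (induction I rule: infinite_finite_induct) (auto simp: emb_add)
  ultimately show ?thesis by simp
qed

lemma semilin_add: "field_embedding \<theta> \<Longrightarrow> semilin \<theta> (x + y) = semilin \<theta> x + semilin \<theta> y"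
  by (simp add: semilin_def coord_add field_embedding_def flip: A_add) (simp add: plus_vec_def)

lemma semilin_scale: "field_embedding \<theta> \<Longrightarrow> semilin \<theta> (c *s x) = \<theta> c *s semilin \<theta> x"
  by (simp add: semilin_def coord_scale field_embedding_def flip: A_scale)
    (simp add: vector_scalar_mult_def)

lemma semilin_compose: "semilin \<theta> (semilin \<eta> x) = semilin (\<lambda>c. \<theta> (\<eta> c)) x"
  by (simp add: semilin_def)

lemma semilin_W: "(\<And>k. \<theta> (emb k) = emb k) \<Longrightarrow> x \<in> W \<Longrightarrow> semilin \<theta> x = x"
  by (auto simp: semilin_def W_eq)

lemma form_semilin:
  assumes "field_embedding \<theta>" "\<And>k. \<theta> (emb k) = emb k"
  shows "form a (semilin \<theta> x) = \<theta> (form a x)"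
proof -
  have "\<theta> 0 = 0"
    using assms(2)[of 0] by simp
  then have "\<theta> (\<Sum>i\<in>I. f i) = (\<Sum>i\<in>I. \<theta> (f i))" for I and f :: "'n \<Rightarrow> 'a"
    using assms(1) by (induction I rule: infinite_finite_induct) (auto simp: field_embedding_def)
  then show ?thesis
    using assms by (simp add: form_def semilin_def field_embedding_def)
qed

section \<open>Frobenius conjugates of a vector\<close>

lemma field_embedding_frob: "field_embedding (\<lambda>x::'a. x ^ (q ^ s))"
  by (simp add: field_embedding_def frob_add power_mult_distrib)

lemma form_Frob: "form a (Frob s x) = form a x ^ (q ^ s)"
  by (simp add: form_semilin field_embedding_frob frob_emb)

lemmas Frob_add = semilin_add[OF field_embedding_frob]
  and Frob_scale = semilin_scale[OF field_embedding_frob]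

lemma Frob_compose: "Frob i (Frob j x) = Frob ((i + j) mod t) x"
  by (simp add: semilin_compose frob_compose add.commute)

lemma Frob_mod: "Frob (i mod t) x = Frob i x"
  by (simp add: frob_mod)

text \<open>Geometrically, the point of \<open>u\<close> lies in no span of a hyperplane of
  \<Sigma>; algebraically, the \<open>t\<close> coordinates of \<open>u\<close> form a basis of the
  large field over the small one.\<close>

definition nondegenerate :: "'a ^ 'n \<Rightarrow> bool" where
  "nondegenerate u \<longleftrightarrow> (\<forall>a. a \<noteq> 0 \<longrightarrow> form a u \<noteq> 0)"

text \<open>Evaluation at \<open>u\<close> is an injective map between two sets of size
  \<open>q ^ t\<close>.\<close>

lemma nondegenerate_surj:
  assumes "nondegenerate u"
  shows "range (\<lambda>a. form a u) = UNIV"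
proof -
  have "inj (\<lambda>a. form a u)"
    using assms by (auto simp: inj_def nondegenerate_def)
      (metis form_diff_left right_minus_eq)
  then have "card (range (\<lambda>a. form a u)) = CARD('k ^ 'n)"
    by (rule card_image)
  then have "card (range (\<lambda>a. form a u)) = CARD('a)"
    by (simp add: card_k card_a card_n)
  then show ?thesis
    by (intro card_subset_eq) auto
qed

lemma image_form_nonzero:
  assumes u: "nondegenerate u"
  shows "(\<lambda>a. form a u) ` (UNIV - {0}) = UNIV - {0}"
proof (intro equalityI subsetI)
  fix x :: 'a assume x: "x \<in> UNIV - {0}"
  obtain a where "x = form a u"
    using nondegenerate_surj[OF u] by (metis UNIV_I image_iff)
  with x show "x \<in> (\<lambda>a. form a u) ` (UNIV - {0})"
    by (cases "a = 0") auto
qed (use u in \<open>auto simp: nondegenerate_def\<close>)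

text \<open>Applying a form to the relation gives a linearized polynomial evaluated at
  \<open>form a u\<close>, and \<open>form a u\<close> takes every value of the field. This argument
  stands in for the Moore determinant.\<close>

lemma Frob_independent:
  assumes u: "nondegenerate u" and "(\<Sum>j<t. c j *s Frob j u) = 0" "j < t"
  shows "c j = 0"
proof (rule frob_independent[OF _ assms(3)])
  fix x :: 'a
  obtain a where "x = form a u"
    using nondegenerate_surj[OF u] by (metis UNIV_I image_iff)
  then show "(\<Sum>j<t. c j * x ^ (q ^ j)) = 0"
    using arg_cong[OF assms(2), of "form a"] by (simp add: form_sum form_scale form_Frob)
qed

text \<open>By independence, distinct coefficient families give distinct vectors, and there are as
  many families as vectors.\<close>

lemma Frob_span:
  assumes u: "nondegenerate u"
  obtains c where "v = (\<Sum>j<t. c j *s Frob j u)"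
proof -
  let ?F = "\<lambda>c. \<Sum>j<t. c j *s Frob j u"
  have "inj_on ?F ({..<t} \<rightarrow>\<^sub>E UNIV)"
  proof (rule inj_onI)
    fix c d assume cd: "c \<in> {..<t} \<rightarrow>\<^sub>E UNIV" "d \<in> {..<t} \<rightarrow>\<^sub>E UNIV" "?F c = ?F d"
    have "(\<Sum>j<t. (c j - d j) *s Frob j u) = 0"
      using cd(3) by (simp add: vec.scale_left_diff_distrib sum_subtractf)
    then have eq: "c j - d j = 0" if "j < t" for j
      using that by (rule Frob_independent[OF u])
    show "c = d"
      by (rule PiE_ext[OF cd(1,2)]) (use eq in simp)
  qed
  then have "card (?F ` ({..<t} \<rightarrow>\<^sub>E UNIV)) = CARD('a ^ 'n)"
    by (simp add: card_image card_funcsetE card_n)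
  then have "?F ` ({..<t} \<rightarrow>\<^sub>E UNIV) = UNIV"
    by (intro card_subset_eq) simp_all
  then have "v \<in> ?F ` ({..<t} \<rightarrow>\<^sub>E UNIV)"
    by simp
  then show ?thesis
    by (rule imageE) (rule that)
qed

text \<open>Comparison of coefficients in a relation between four conjugates. Only \<open>i\<close>
  has to differ from the other indices modulo \<open>t\<close>; those may coincide among
  themselves.\<close>

lemma Frob_coeff_eq_0:
  assumes u: "nondegenerate u"
    and sum: "\<alpha> *s Frob i u + \<beta> *s Frob j u = \<gamma> *s Frob k u + \<delta> *s Frob l u"
    and neq: "i mod t \<noteq> j mod t" "i mod t \<noteq> k mod t" "i mod t \<noteq> l mod t"
  shows "\<alpha> = 0"
proof -
  define e where "e x m n = (if n = m mod t then x else 0)" for x :: 'a and m n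
  have e: "(\<Sum>n<t. e x m n *s Frob n u) = x *s Frob m u" for x m
  proof -
    have "(\<Sum>n<t. e x m n *s Frob n u) = (\<Sum>n\<in>{m mod t}. e x m n *s Frob n u)"
      by (rule sum.mono_neutral_right) (use t_ge_3 in \<open>auto simp: e_def\<close>)
    then show ?thesis
      by (simp add: e_def frob_mod)
  qed
  have "(\<Sum>n<t. (e \<alpha> i n + e \<beta> j n - e \<gamma> k n - e \<delta> l n) *s Frob n u) = 0"
    using sum by (simp only: vec.scale_left_diff_distrib vec.scale_left_distrib sum_subtractf sum.distrib e)
      simp
  from Frob_independent[OF u this, of "i mod t"] show ?thesis
    using t_ge_3 neq by (simp add: e_def)
qed

text \<open>Expanding \<open>semilin \<theta> u\<close> in the conjugates of \<open>u\<close>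
  presents \<open>\<theta>\<close> as a linearized polynomial. Comparing coefficients in
  \<open>\<theta> (y * x) = \<theta> y * \<theta> x\<close> shows
  \<open>\<theta> y = y ^ (q ^ s)\<close> for each \<open>s\<close> with nonzero coefficient, and
  \<open>\<theta> 1 = 1\<close> provides such an \<open>s\<close>.\<close>

lemma embedding_eq_frob:
  assumes "field_embedding \<theta>" "\<And>k. \<theta> (emb k) = emb k" and u: "nondegenerate u"
  shows "\<exists>s<t. \<forall>x. \<theta> x = x ^ (q ^ s)"
proof -
  obtain c where c: "semilin \<theta> u = (\<Sum>j<t. c j *s Frob j u)"
    using Frob_span[OF u] .
  have \<theta>: "\<theta> x = (\<Sum>j<t. c j * x ^ (q ^ j))" for x
  proof -
    obtain a where "x = form a u"
      using nondegenerate_surj[OF u] by (metis UNIV_I image_iff)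
    then show ?thesis
      using arg_cong[OF c, of "form a"]
      by (simp add: form_sum form_scale form_Frob form_semilin[OF assms(1,2)])
  qed
  obtain s where s: "s < t" "c s \<noteq> 0"
    using \<theta>[of 1] assms(1) by (auto simp: field_embedding_def) (metis sum.neutral lessThan_iff zero_neq_one)
  have "\<theta> y = y ^ (q ^ s)" for y
  proof -
    have "(\<Sum>j<t. (c j * y ^ (q ^ j) - \<theta> y * c j) * x ^ (q ^ j)) = 0" for x
    proof -
      have "(\<Sum>j<t. c j * y ^ (q ^ j) * x ^ (q ^ j)) = \<theta> (y * x)"
        unfolding \<theta>[of "y * x"] by (simp add: power_mult_distrib mult.assoc)
      also have "\<dots> = \<theta> y * \<theta> x"
        using assms(1) by (simp add: field_embedding_def)
      also have "\<dots> = (\<Sum>j<t. \<theta> y * c j * x ^ (q ^ j))"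
        unfolding \<theta>[of x] by (simp add: sum_distrib_left mult.assoc)
      finally show ?thesis
        by (simp add: left_diff_distrib sum_subtractf)
    qed
    then have "c s * y ^ (q ^ s) - \<theta> y * c s = 0"
      by (rule frob_independent) (rule s(1))
    then show ?thesis
      using s(2) by (simp add: mult.commute)
  qed
  then show ?thesis
    using s(1) by blast
qed

text \<open>Both inclusions are the same argument, since the ratios of an iterate of a power map are
  among the ratios of the map itself: \<open>x ^ (q ^ s)\<close> is an iterate of
  \<open>x ^ q\<close>, and conversely \<open>x ^ q\<close> is the \<open>k\<close>-th iterate of
  \<open>x ^ (q ^ s)\<close> when \<open>k\<close> inverts \<open>s\<close> modulo
  \<open>t\<close>.\<close>

lemma frob_ratio_image:
  assumes "coprime s t"
  shows "(\<lambda>x::'a. x ^ (q ^ s) / x) ` (UNIV - {0}) = (\<lambda>x. x ^ q / x) ` (UNIV - {0})"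
proof -
  have sub: "(\<lambda>x::'a. x ^ (r ^ n) / x) ` (UNIV - {0}) \<subseteq> (\<lambda>x. x ^ r / x) ` (UNIV - {0})" for r n
  proof (rule image_subsetI)
    fix x :: 'a assume "x \<in> UNIV - {0}"
    then have "x \<noteq> 0" by simp
    define m where "m = (\<Sum>i<n. r ^ i)"
    have "x ^ (r ^ n) * x ^ m = x * (x ^ m) ^ r"
      unfolding m_def by (rule power_power_split)
    then have "x ^ (r ^ n) / x = (x ^ m) ^ r / x ^ m"
      using \<open>x \<noteq> 0\<close> by (simp add: frac_eq_eq mult.commute)
    then show "x ^ (r ^ n) / x \<in> (\<lambda>x. x ^ r / x) ` (UNIV - {0})"
      using \<open>x \<noteq> 0\<close> by auto
  qed
  obtain k where k: "[s * k = 1] (mod t)"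
    using cong_solve_coprime_nat[OF assms] by auto
  have "x ^ q = x ^ ((q ^ s) ^ k)" for x :: 'a
    using k frob_mod[of x "s * k"] frob_mod[of x 1]
    by (simp add: unique_euclidean_semiring_class.cong_def power_mult)
  then show ?thesis
    using sub[of q s] sub[of "q ^ s" k] by auto
qed

lemma Frob_if_ratio_image_eq:
  assumes u: "nondegenerate u"
    and ratio: "(\<lambda>a. form a v / form a u) ` (UNIV - {0}) = (\<lambda>x. x ^ q / x) ` (UNIV - {0})"
  shows "\<exists>s<t. \<exists>c. coprime s t \<and> c \<noteq> 0 \<and> v = c *s Frob s u"
proof -
  obtain c where c: "v = (\<Sum>j<t. c j *s Frob j u)"
    using Frob_span[OF u] .
  have form_v: "form a v = (\<Sum>j<t. c j * form a u ^ (q ^ j))" for a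
    unfolding c by (simp add: form_sum form_scale form_Frob)
  have "(\<lambda>x. (\<Sum>j<t. c j * x ^ (q ^ j)) / x) ` (UNIV - {0}) = (\<lambda>a. form a v / form a u) ` (UNIV - {0})"
    unfolding image_form_nonzero[OF u, symmetric] image_image form_v ..
  then have "(\<lambda>x. (\<Sum>j<t. c j * x ^ (q ^ j)) / x) ` (UNIV - {0}) = (\<lambda>x. x ^ q / x) ` (UNIV - {0})"
    using ratio by (rule trans)
  from linearized_ratio_set_eq_imp_monomial[OF this] obtain s where
    s: "s < t" "coprime s t" "c s \<noteq> 0" "\<And>j. j < t \<Longrightarrow> j \<noteq> s \<Longrightarrow> c j = 0"
    by blast
  have "v = (\<Sum>j\<in>{s}. c j *s Frob j u)"
    unfolding c by (rule sum.mono_neutral_right) (use s in auto)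
  then show ?thesis
    using s by auto
qed

end

section \<open>Projectivities onto a line\<close>

definition basis2 :: "('a::field ^ 'n) set \<Rightarrow> 'a ^ 'n \<Rightarrow> 'a ^ 'n \<Rightarrow> bool" where
  "basis2 L p r \<longleftrightarrow> L = {x *s p + y *s r | x y. True}
     \<and> (\<forall>x y. x *s p + y *s r = 0 \<longrightarrow> x = 0 \<and> y = 0)"

lemma basis2_eqD:
  assumes "basis2 L p r" "x *s p + y *s r = x' *s p + y' *s r"
  shows "x = x' \<and> y = y'"
proof -
  have "(x - x') *s p + (y - y') *s r = 0"
    using assms(2) by (simp add: vec.scale_left_diff_distrib algebra_simps)
  then show ?thesis
    using assms(1) unfolding basis2_def by (metis right_minus_eq)
qed

lemma basis2_memD:
  assumes "basis2 L p r"
  shows "p \<in> L" "r \<in> L" "p \<noteq> 0" "r \<noteq> 0"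
proof -
  have eqs: "p = 1 *s p + 0 *s r" "r = 0 *s p + 1 *s r"
    by simp_all
  show "p \<in> L" "r \<in> L"
    using assms eqs unfolding basis2_def by blast+
  show "p \<noteq> 0" "r \<noteq> 0"
    using basis2_eqD[OF assms, of 1 0 0 0] basis2_eqD[OF assms, of 0 1 0 0] by auto
qed

lemma vec_span_pair: "vec.span {p, r} = {x *s p + y *s r | x y. True}"
  for p r :: "'a::field ^ 'n"
proof -
  have "vec.span {p, r} = {z. \<exists>x y. z - x *s p = y *s r}"
    by (auto simp: vec.span_insert[of p] vec.span_singleton)
  then show ?thesis
    by (auto simp: diff_eq_eq add.commute)
qed

lemma ex_basis2:
  fixes L :: "('a::field ^ 'n) set"
  assumes "vec.subspace L" "vec.dim L = 2"
  obtains p r where "basis2 L p r"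
proof -
  obtain B where B: "B \<subseteq> L" "vec.independent B" "L \<subseteq> vec.span B" "card B = 2"
    using vec.basis_exists[of L] assms(2) by metis
  obtain p r where pr: "B = {p, r}" "p \<noteq> r"
    using B(4) by (auto simp: card_2_iff)
  have "L = vec.span {p, r}"
    using B vec.span_minimal[OF B(1) assms(1)] pr by auto
  then have "L = {x *s p + y *s r | x y. True}"
    unfolding vec_span_pair .
  moreover have "x = 0 \<and> y = 0" if "x *s p + y *s r = 0" for x y
  proof -
    have r: "r \<noteq> 0" "p \<notin> vec.span {r}"
      using B(2) pr by (auto simp: vec.independent_insert)
    have "x = 0"
    proof (rule ccontr)
      assume "x \<noteq> 0"
      have "x *s p = (- y) *s r"
        using that by (simp add: eq_neg_iff_add_eq_0)
      then have "p = (- y / x) *s r"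
        using \<open>x \<noteq> 0\<close> by (metis divide_inverse_commute vec.scale_scale vec.scale_left_imp_eq
            nonzero_mult_div_cancel_left times_divide_eq_right)
      then have "p \<in> vec.span {r}"
        by (metis vec.span_base vec.span_scale insertI1)
      then show False
        using r by simp
    qed
    then show ?thesis
      using that r by simp
  qed
  ultimately show ?thesis
    using that by (auto simp: basis2_def)
qed

text \<open>The pairs of coefficients inject into \<open>L\<close> through \<open>u\<close>,
  \<open>v\<close> as well as through a known basis, so finiteness makes the two ranges
  equal.\<close>

lemma basis2_if_independent:
  fixes L :: "('a::{field,finite} ^ 'n) set"
  assumes L: "vec.subspace L" "vec.dim L = 2" and uv: "u \<in> L" "v \<in> L"
    and indep: "\<And>x y. x *s u + y *s v = 0 \<Longrightarrow> x = 0 \<and> y = 0"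
  shows "basis2 L u v"
proof -
  let ?f = "\<lambda>p r (x, y). x *s p + y *s r"
  obtain p r where pr: "basis2 L p r"
    using ex_basis2[OF L] .
  have inj: "inj (?f p r)"
    using basis2_eqD[OF pr] by (auto simp: inj_def)
  have "x = x' \<and> y = y'" if "x *s u + y *s v = x' *s u + y' *s v" for x y x' y'
  proof -
    have "(x - x') *s u + (y - y') *s v = 0"
      using that by (simp add: vec.scale_left_diff_distrib algebra_simps)
    then show ?thesis
      using indep by (metis right_minus_eq)
  qed
  then have inj': "inj (?f u v)"
    by (auto simp: inj_def)
  have "range (?f p r) = L"
    using pr by (auto simp: basis2_def)
  moreover have "range (?f u v) \<subseteq> L"
    using L uv by (auto simp: vec.subspace_add vec.subspace_scale)
  moreover have "card (range (?f u v)) = card (range (?f p r))"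
    using inj inj' by (simp add: card_image)
  ultimately have "range (?f u v) = L"
    by (intro card_subset_eq) auto
  then show ?thesis
    using indep by (auto simp: basis2_def)
qed

lemma inj_span_affine:
  fixes p r :: "'a::field ^ 'n"
  assumes pr: "basis2 L p r"
  shows "inj (\<lambda>m. vec.span {p + m *s r})"
proof (rule injI)
  fix m m' assume "vec.span {p + m *s r} = vec.span {p + m' *s r}"
  moreover have "p + m *s r \<noteq> 0"
    using basis2_eqD[OF pr, of 1 m 0 0] by auto
  ultimately obtain c where "p + m' *s r = c *s (p + m *s r)"
    by (auto simp: span_singleton_eq_iff)
  then have "1 *s p + m' *s r = c *s p + (c * m) *s r"
    by (simp add: vec.scale_right_distrib)
  then show "m = m'"
    using basis2_eqD[OF pr] by fastforce
qed

text \<open>Points other than that of \<open>r\<close> are compared through the affine coordinate,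
  the quotient of the coefficients. As the family over \<open>J\<close> avoids the point of
  \<open>r\<close>, equality also keeps the family over \<open>I\<close> away from it; for a splash
  this becomes nondegeneracy of \<open>r\<close>.\<close>

lemma span_image_ratio_iff:
  fixes p r :: "'a::field ^ 'n"
  assumes pr: "basis2 L p r" and nz: "\<And>i. i \<in> I \<Longrightarrow> \<alpha> i \<noteq> 0 \<or> \<beta> i \<noteq> 0" and nz': "\<And>j. j \<in> J \<Longrightarrow> \<gamma> j \<noteq> 0"
  shows "(\<lambda>i. vec.span {\<alpha> i *s p + \<beta> i *s r}) ` I = (\<lambda>j. vec.span {\<gamma> j *s p + \<delta> j *s r}) ` J
    \<longleftrightarrow> (\<forall>i\<in>I. \<alpha> i \<noteq> 0) \<and> (\<lambda>i. \<beta> i / \<alpha> i) ` I = (\<lambda>j. \<delta> j / \<gamma> j) ` J"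
proof -
  let ?S = "\<lambda>m. vec.span {p + m *s r}"
  have norm: "vec.span {x *s p + y *s r} = ?S (y / x)" if "x \<noteq> 0" for x y
    using that span_singleton_scale[of x "p + (y / x) *s r"] by (simp add: vec.scale_right_distrib)
  have ne: "x *s p + y *s r \<noteq> 0" if "x \<noteq> 0 \<or> y \<noteq> 0" for x y
    using that pr by (auto simp: basis2_def)
  have inj: "inj ?S"
    by (rule inj_span_affine[OF pr])
  have J: "(\<lambda>j. vec.span {\<gamma> j *s p + \<delta> j *s r}) ` J = ?S ` (\<lambda>j. \<delta> j / \<gamma> j) ` J"
    unfolding image_image by (rule image_cong) (use nz' norm in auto)
  have I: "(\<lambda>i. vec.span {\<alpha> i *s p + \<beta> i *s r}) ` I = ?S ` (\<lambda>i. \<beta> i / \<alpha> i) ` I" if "\<forall>i\<in>I. \<alpha> i \<noteq> 0"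
    unfolding image_image by (rule image_cong) (use that norm in auto)
  show ?thesis
  proof (intro iffI conjI ballI)
    assume eq: "(\<lambda>i. vec.span {\<alpha> i *s p + \<beta> i *s r}) ` I = (\<lambda>j. vec.span {\<gamma> j *s p + \<delta> j *s r}) ` J"
    show \<alpha>: "\<alpha> i \<noteq> 0" if i: "i \<in> I" for i
    proof -
      have "vec.span {\<alpha> i *s p + \<beta> i *s r} \<in> ?S ` (\<lambda>j. \<delta> j / \<gamma> j) ` J"
        using eq i unfolding J by blast
      then obtain m where "vec.span {\<alpha> i *s p + \<beta> i *s r} = ?S m"
        by blast
      then obtain c where "p + m *s r = c *s (\<alpha> i *s p + \<beta> i *s r)"
        using ne nz[OF i] by (auto simp: span_singleton_eq_iff)
      then have "1 *s p + m *s r = (c * \<alpha> i) *s p + (c * \<beta> i) *s r"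
        by (simp add: vec.scale_right_distrib)
      then have "1 = c * \<alpha> i"
        using basis2_eqD[OF pr] by blast
      then show ?thesis
        by auto
    qed
    then show "(\<lambda>i. \<beta> i / \<alpha> i) ` I = (\<lambda>j. \<delta> j / \<gamma> j) ` J"
      using eq I J inj by (simp add: inj_image_eq_iff)
  next
    assume "(\<forall>i\<in>I. \<alpha> i \<noteq> 0) \<and> (\<lambda>i. \<beta> i / \<alpha> i) ` I = (\<lambda>j. \<delta> j / \<gamma> j) ` J"
    then show "(\<lambda>i. vec.span {\<alpha> i *s p + \<beta> i *s r}) ` I = (\<lambda>j. vec.span {\<gamma> j *s p + \<delta> j *s r}) ` J"
      using I J by simp
  qed
qed

definition pair_map :: "'a::field ^ 'n \<Rightarrow> 'a ^ 'n \<Rightarrow> 'a ^ 2 \<Rightarrow> 'a ^ 'n" where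
  "pair_map p r z = z $ 1 *s p + z $ 2 *s r"

lemma pair_map_image_span: "pair_map p r ` vec.span {vector [x, y]} = vec.span {x *s p + y *s r}"
  unfolding vec.span_singleton image_image
  by (rule image_cong) (auto simp: pair_map_def vec.scale_right_distrib)

lemma linear_pair_map: "Vector_Spaces.linear (*s) (*s) (pair_map p r)"
  by unfold_locales (auto simp: pair_map_def algebra_simps vec.scale_left_distrib vec.scale_right_distrib)

text \<open>A projectivity is given by the images \<open>p\<close>, \<open>r\<close> of the two unit
  vectors, and these represent the candidates for the transversal points.\<close>

lemma projectivity_onto_iff:
  fixes L :: "('a::field ^ 'n) set"
  shows "projectivity_onto L \<phi> \<longleftrightarrow> (\<exists>p r. basis2 L p r \<and> (\<forall>P \<in> PG UNIV. \<phi> P = pair_map p r ` P))"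
proof
  assume "projectivity_onto L \<phi>"
  then obtain f where f: "Vector_Spaces.linear (*s) (*s) f" "inj f" "range f = L"
      "\<forall>P \<in> PG UNIV. \<phi> P = f ` P"
    by (auto simp: projectivity_onto_def)
  define p r where "p = f (vector [1, 0])" and "r = f (vector [0, 1])"
  have "f z = pair_map p r z" for z
  proof -
    have "z = z $ 1 *s vector [1, 0] + z $ 2 *s vector [0, 1]"
      by (simp add: vec_eq_iff forall_2)
    then have "f z = f (z $ 1 *s vector [1, 0] + z $ 2 *s vector [0, 1])"
      by simp
    also have "\<dots> = pair_map p r z"
      using f(1) by (simp add: linear_iff_module_hom module_hom.add module_hom.scale pair_map_def p_def r_def)
    finally show ?thesis .
  qed
  then have f_eq: "f = pair_map p r"
    by blast
  have "basis2 L p r"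
    unfolding basis2_def
  proof (intro conjI allI impI)
    show "L = {x *s p + y *s r | x y. True}"
    proof (intro equalityI subsetI)
      fix z assume "z \<in> L"
      then show "z \<in> {x *s p + y *s r | x y. True}"
        using f(3) unfolding f_eq pair_map_def by blast
    next
      fix z assume "z \<in> {x *s p + y *s r | x y. True}"
      then obtain x y where "z = f (vector [x, y])"
        by (auto simp: f_eq pair_map_def)
      then show "z \<in> L"
        using f(3) by auto
    qed
    fix x y assume "x *s p + y *s r = 0"
    then have "f (vector [x, y]) = f 0"
      by (simp add: f_eq pair_map_def)
    then have "vector [x, y] = (0 :: 'a ^ 2)"
      using f(2) by (simp add: inj_eq)
    then show "x = 0" "y = 0"
      by (simp_all add: vec_eq_iff forall_2)
  qed
  then show "\<exists>p r. basis2 L p r \<and> (\<forall>P \<in> PG UNIV. \<phi> P = pair_map p r ` P)"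
    using f(4) f_eq by blast
next
  assume "\<exists>p r. basis2 L p r \<and> (\<forall>P \<in> PG UNIV. \<phi> P = pair_map p r ` P)"
  then obtain p r where pr: "basis2 L p r" and \<phi>: "\<forall>P \<in> PG UNIV. \<phi> P = pair_map p r ` P"
    by blast
  have "inj (pair_map p r)"
  proof (rule injI)
    fix z z' :: "'a ^ 2" assume "pair_map p r z = pair_map p r z'"
    then have "z $ 1 = z' $ 1 \<and> z $ 2 = z' $ 2"
      unfolding pair_map_def by (rule basis2_eqD[OF pr])
    then show "z = z'"
      by (simp add: vec_eq_iff forall_2)
  qed
  moreover have "range (pair_map p r) = L"
  proof (intro equalityI subsetI)
    fix z assume "z \<in> L"
    then obtain x y where "z = pair_map p r (vector [x, y])"
      using pr by (auto simp: basis2_def pair_map_def)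
    then show "z \<in> range (pair_map p r)"
      by blast
  qed (use pr in \<open>auto simp: basis2_def pair_map_def\<close>)
  ultimately show "projectivity_onto L \<phi>"
    unfolding projectivity_onto_def using \<phi> linear_pair_map by blast
qed

lemma projectivity_span:
  assumes "\<forall>P \<in> PG UNIV. \<phi> P = pair_map p r ` P" "x \<noteq> 0 \<or> y \<noteq> 0"
  shows "\<phi> (vec.span {vector [x, y]}) = vec.span {x *s p + y *s r}"
proof -
  have "vector [x, y] \<noteq> (0 :: 'a ^ 2)"
    using assms(2) by (auto simp: vec_eq_iff forall_2)
  then have "vec.span {vector [x, y]} \<in> PG (UNIV :: ('a ^ 2) set)"
    by (auto simp: PG_def)
  then show ?thesis
    using assms(1) by (simp add: pair_map_image_span)
qed

lemma projectivity_image_model: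
  fixes p r :: "'a::field ^ 'n"
  assumes "\<forall>P \<in> PG UNIV. \<phi> P = pair_map p r ` P"
  shows "\<phi> ` pseudoregulus_model q = (\<lambda>c. vec.span {c *s p + c ^ q *s r}) ` (UNIV - {0})"
proof -
  have "(pseudoregulus_model q :: ('a ^ 2) set set) = (\<lambda>c. vec.span {vector [c, c ^ q]}) ` (UNIV - {0})"
    by (auto simp: pseudoregulus_model_def)
  then have "\<phi> ` pseudoregulus_model q = (\<lambda>c. \<phi> (vec.span {vector [c, c ^ q]})) ` (UNIV - {0})"
    by (simp only: image_image)
  also have "\<dots> = (\<lambda>c. vec.span {c *s p + c ^ q *s r}) ` (UNIV - {0})"
    by (rule image_cong) (use projectivity_span[OF assms] in auto)
  finally show ?thesis .
qed

section \<open>The splash\<close>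

context canonical_frame
begin

sublocale k: vector_space "kscale emb :: 'k \<Rightarrow> 'a ^ 'n \<Rightarrow> 'a ^ 'n"
  by (rule vector_space_kscale) (rule field_embedding_emb)

lemma card_ksubspace: "k.subspace U \<Longrightarrow> card U = q ^ k.dim U"
  using card_subspace_finite_field[of "kscale emb" U] k.vector_space_axioms by (simp add: card_k)

definition frame :: "'n \<Rightarrow> 'a ^ 'n" where
  "frame i = A (axis i 1)"

lemma frame_in_W: "frame i \<in> W"
  unfolding frame_def in_W_iff by (auto simp: axis_def image_iff intro: exI[of _ 0] exI[of _ 1])

lemma form_frame: "form a (frame i) = emb (a $ i)"
proof -
  have "emb (a $ j) * axis i 1 $ j = (if j = i then emb (a $ j) else 0)" for j
    by (simp add: axis_def)
  then show ?thesis
    by (simp add: form_def frame_def)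
qed

lemma frame_expand: "x = (\<Sum>i\<in>UNIV. coord x $ i *s frame i)"
proof (rule eq_if_forms_eq)
  fix a
  show "form a x = form a (\<Sum>i\<in>UNIV. coord x $ i *s frame i)"
    by (simp add: form_sum form_scale form_frame form_def[of a x] mult.commute)
qed

lemma subspace_W: "k.subspace W"
proof -
  have "0 \<in> range emb" "\<And>x y. x \<in> range emb \<Longrightarrow> y \<in> range emb \<Longrightarrow> x + y \<in> range emb"
    "\<And>c x. x \<in> range emb \<Longrightarrow> emb c * x \<in> range emb"
    by (metis emb_0 rangeI) (auto simp flip: emb_add emb_mult)
  then show ?thesis
    by (simp add: k.subspace_def kscale_def in_W_iff coord_add coord_scale)
qed

lemma card_W: "card W = q ^ t"
proof -
  have "inj (\<lambda>a :: 'k ^ 'n. A (\<chi> i. emb (a $ i)))"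
  proof (rule injI)
    fix a b :: "'k ^ 'n"
    assume "A (\<chi> i. emb (a $ i)) = A (\<chi> i. emb (b $ i))"
    then have "coord (A (\<chi> i. emb (a $ i))) = coord (A (\<chi> i. emb (b $ i)))"
      by (rule arg_cong)
    then show "a = b"
      using inj_emb by (simp add: vec_eq_iff inj_eq)
  qed
  then show ?thesis
    by (simp add: W_eq card_image card_k card_n)
qed

lemma dim_W: "k.dim W = t"
  using card_ksubspace[OF subspace_W] card_W q_ge_2 by simp

lemma card_extend_ksubspace:
  assumes H: "k.subspace H" and "w \<notin> H"
  shows "card ((\<lambda>(c, h). kscale emb c w + h) ` (UNIV \<times> H)) = q * card H"
proof -
  have "inj_on (\<lambda>(c, h). kscale emb c w + h) (UNIV \<times> H)"
  proof (rule inj_onI, clarify)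
    fix c c' h h'
    assume h: "h \<in> H" "h' \<in> H" and eq: "kscale emb c w + h = kscale emb c' w + h'"
    have "kscale emb (c - c') w = h' - h"
      using eq by (simp add: k.scale_left_diff_distrib algebra_simps)
    then have "kscale emb (c - c') w \<in> H"
      using h H by (simp add: k.subspace_diff)
    then have "c = c'"
      using assms(2) k.subspace_scale[OF H, of "kscale emb (c - c') w" "inverse (c - c')"]
      by (cases "c = c'") auto
    then show "c = c' \<and> h = h'"
      using eq by simp
  qed
  then show ?thesis
    by (simp add: card_image card_cartesian_product card_k)
qed

lemma hyperplane_of_form:
  assumes "a \<noteq> 0"
  shows "k.subspace {x \<in> W. form a x = 0}" "k.dim {x \<in> W. form a x = 0} = t - 1"
proof -
  let ?H = "{x \<in> W. form a x = 0}"
  show H: "k.subspace ?H"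
    using subspace_W by (auto simp: k.subspace_def kscale_def form_add form_scale)
  obtain i where i: "a $ i \<noteq> 0"
    using assms by (auto simp: vec_eq_iff)
  let ?f = "\<lambda>(c, h). kscale emb c (frame i) + h"
  have "?f ` (UNIV \<times> ?H) = W"
  proof (intro equalityI subsetI)
    fix x assume "x \<in> ?f ` (UNIV \<times> ?H)"
    then show "x \<in> W"
      using subspace_W frame_in_W by (auto simp: k.subspace_add k.subspace_scale)
  next
    fix x assume x: "x \<in> W"
    then obtain c where c: "form a x = emb c"
      using form_W by blast
    have "x - kscale emb (c / a $ i) (frame i) \<in> W"
      using subspace_W frame_in_W x by (simp add: k.subspace_diff k.subspace_scale)
    moreover have "form a (x - kscale emb (c / a $ i) (frame i)) = 0"
      using i c by (simp add: form_diff kscale_def form_scale form_frame flip: emb_mult)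
    ultimately show "x \<in> ?f ` (UNIV \<times> ?H)"
      by (intro image_eqI[of _ _ "(c / a $ i, x - kscale emb (c / a $ i) (frame i))"]) auto
  qed
  then have "q ^ t = q * q ^ k.dim ?H"
    using card_extend_ksubspace[OF H, of "frame i"] i
    by (simp add: form_frame card_W card_ksubspace[OF H])
  then have "q ^ t = q ^ Suc (k.dim ?H)"
    by simp
  then have "t = Suc (k.dim ?H)"
    using q_ge_2 by (simp only: power_inject_exp)
  then show "k.dim ?H = t - 1"
    by simp
qed

text \<open>The form is the coordinate along a vector \<open>w\<close> of \<open>W\<close> outside
  \<open>H\<close>. Counting shows that \<open>H\<close> and \<open>w\<close> generate
  \<open>W\<close>, and \<open>a $ i\<close> is the coefficient of \<open>w\<close> in
  \<open>frame i\<close> modulo \<open>H\<close>.\<close>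

lemma form_of_hyperplane:
  assumes H: "k.subspace H" "H \<subseteq> W" "k.dim H = t - 1"
  obtains a where "a \<noteq> 0" "H = {x \<in> W. form a x = 0}"
proof -
  have card_H: "q * card H = card W"
    using card_ksubspace[OF H(1)] H(3) card_W t_ge_3 by (simp flip: power_Suc)
  moreover have "0 < card H"
    using card_ksubspace[OF H(1)] q_ge_2 by simp
  ultimately have "H \<noteq> W"
    using q_ge_2 by auto
  then obtain w where w: "w \<in> W" "w \<notin> H"
    using H(2) by blast
  let ?f = "\<lambda>(c, h). kscale emb c w + h"
  have "?f ` (UNIV \<times> H) = W"
  proof (rule card_subset_eq)
    show "?f ` (UNIV \<times> H) \<subseteq> W"
      using H(2) w subspace_W by (auto simp: k.subspace_add k.subspace_scale)
  qed (use card_extend_ksubspace[OF H(1) w(2)] card_H in auto)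
  then have image: "frame i \<in> ?f ` (UNIV \<times> H)" for i
    using frame_in_W by simp
  have "\<exists>c. frame i - kscale emb c w \<in> H" for i
  proof -
    obtain c h where "frame i = kscale emb c w + h" "h \<in> H"
      using image[of i] by auto
    then show ?thesis
      by (intro exI[of _ c]) simp
  qed
  then obtain c where c: "\<And>i. frame i - kscale emb (c i) w \<in> H"
    by metis
  define a where "a = (\<chi> i. c i)"
  have iff: "x \<in> H \<longleftrightarrow> form a x = 0" if x: "x \<in> W" for x
  proof -
    obtain b where b: "coord x = (\<chi> i. emb (b $ i))"
      using x by (auto simp: W_eq)
    have "(\<Sum>i\<in>UNIV. kscale emb (b $ i) (frame i - kscale emb (c i) w)) \<in> H"
      using c H(1) by (intro k.subspace_sum k.subspace_scale)
    also have "(\<Sum>i\<in>UNIV. kscale emb (b $ i) (frame i - kscale emb (c i) w)) = x - form a x *s w"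
      by (subst (2) frame_expand)
        (simp add: b kscale_def form_def a_def vec.scale_right_diff_distrib sum_subtractf
          vec.scale_sum_left mult.commute)
    finally have d: "x - form a x *s w \<in> H" .
    obtain e where e: "form a x = emb e"
      using form_W[OF x] by blast
    show ?thesis
    proof
      assume "x \<in> H"
      then have "x - (x - form a x *s w) \<in> H"
        by (intro k.subspace_diff[OF H(1)] d)
      then have ew: "kscale emb e w \<in> H"
        by (simp add: e kscale_def)
      have "e = 0"
        using w(2) k.subspace_scale[OF H(1) ew, of "inverse e"] by (cases "e = 0") auto
      then show "form a x = 0"
        by (simp add: e)
    qed (use d in simp)
  qed
  then have "H = {x \<in> W. form a x = 0}"
    using H(2) by blast
  moreover have "a \<noteq> 0"
    using iff[OF w(1)] w(2) by auto
  ultimately show ?thesis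
    by (intro that)
qed

lemma subspace_form_kernel: "vec.subspace {x. form a x = 0}"
  by (auto simp: vec.subspace_def form_add form_scale)

lemma span_hyperplane:
  assumes "a \<noteq> 0"
  shows "vec.span {x \<in> W. form a x = 0} = {x. form a x = 0}"
proof (intro equalityI subsetI[of "{x. form a x = 0}"])
  show "vec.span {x \<in> W. form a x = 0} \<subseteq> {x. form a x = 0}"
    by (rule vec.span_minimal[OF _ subspace_form_kernel]) auto
next
  fix x assume "x \<in> {x. form a x = 0}"
  then have x: "(\<Sum>j\<in>UNIV. emb (a $ j) * coord x $ j) = 0"
    by (simp add: form_def)
  obtain i where i: "a $ i \<noteq> 0"
    using assms by (auto simp: vec_eq_iff)
  \<comment> \<open>These vectors of \<open>W\<close> lie in the kernel. Combined with the
    coordinates of \<open>x\<close> they give \<open>x\<close> minus a multiple of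
    \<open>frame i\<close> whose factor is proportional to \<open>form a x\<close>, that is,
    \<open>x\<close> itself.\<close>
  define h where "h j = frame j - kscale emb (a $ j / a $ i) (frame i)" for j
  have "h j \<in> {x \<in> W. form a x = 0}" for j
  proof -
    have "form a (h j) = 0"
      using i by (simp add: h_def kscale_def form_diff form_scale form_frame flip: emb_mult)
    moreover have "h j \<in> W"
      unfolding h_def using subspace_W frame_in_W by (simp add: k.subspace_diff k.subspace_scale)
    ultimately show ?thesis by simp
  qed
  then have "(\<Sum>j\<in>UNIV. coord x $ j *s h j) \<in> vec.span {x \<in> W. form a x = 0}"
    by (intro vec.span_sum vec.span_scale vec.span_base)
  also have "(\<Sum>j\<in>UNIV. coord x $ j *s h j)
      = x - (\<Sum>j\<in>UNIV. coord x $ j * emb (a $ j / a $ i)) *s frame i"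
    by (subst (2) frame_expand)
      (simp add: h_def kscale_def vec.scale_right_diff_distrib sum_subtractf vec.scale_sum_left)
  also have "(\<Sum>j\<in>UNIV. coord x $ j * emb (a $ j / a $ i))
      = (\<Sum>j\<in>UNIV. emb (a $ j) * coord x $ j) * emb (1 / a $ i)"
    unfolding sum_distrib_right by (rule sum.cong) (simp_all add: ac_simps flip: emb_mult)
  finally show "x \<in> vec.span {x \<in> W. form a x = 0}"
    by (simp add: x)
qed

lemma sub_hyperplanes_eq:
  "proj_span ` sub_hyperplanes emb W = (\<lambda>a. PG {x. form a x = 0}) ` (UNIV - {0})"
proof -
  have "sub_hyperplanes emb W = (\<lambda>a. PG {x \<in> W. form a x = 0}) ` (UNIV - {0})"
  proof (intro equalityI subsetI)
    fix X assume "X \<in> sub_hyperplanes emb W"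
    then obtain H where H: "X = PG H" "k.subspace H" "H \<subseteq> W" "k.dim H = t - 1"
      by (auto simp: sub_hyperplanes_def dim_W)
    obtain a where a: "a \<noteq> 0" "H = {x \<in> W. form a x = 0}"
      using form_of_hyperplane[OF H(2-4)] .
    show "X \<in> (\<lambda>a. PG {x \<in> W. form a x = 0}) ` (UNIV - {0})"
      by (rule image_eqI[of _ _ a]) (simp_all add: H(1) a)
  next
    fix X assume "X \<in> (\<lambda>a. PG {x \<in> W. form a x = 0}) ` (UNIV - {0})"
    then obtain a where a: "a \<noteq> 0" "X = PG {x \<in> W. form a x = 0}"
      by auto
    show "X \<in> sub_hyperplanes emb W"
      unfolding sub_hyperplanes_def a(2) dim_W
      by (intro CollectI exI[of _ "{x \<in> W. form a x = 0}"] conjI refl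
          hyperplane_of_form[OF a(1)]) blast
  qed
  moreover have "proj_span (PG {x \<in> W. form a x = 0}) = PG {x. form a x = 0}" if "a \<noteq> 0" for a
    by (simp add: proj_span_def span_Union_PG span_hyperplane[OF that])
  ultimately show ?thesis
    by (simp add: image_image)
qed

lemma form_kernel_Int:
  assumes pr: "basis2 L p r" and "form a p \<noteq> 0 \<or> form a r \<noteq> 0"
  shows "L \<inter> {x. form a x = 0} = vec.span {form a r *s p - form a p *s r}"
proof (intro equalityI subsetI)
  fix z assume z: "z \<in> L \<inter> {x. form a x = 0}"
  then obtain x y where xy: "z = x *s p + y *s r"
    using pr by (auto simp: basis2_def)
  have eq: "x * form a p + y * form a r = 0"
    using z by (simp add: xy form_add form_scale)
  have "\<exists>c. x = c * form a r \<and> y = - c * form a p"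
  proof (cases "form a r = 0")
    case True
    then show ?thesis
      using eq assms(2) by (intro exI[of _ "- y / form a p"]) auto
  next
    case False
    then show ?thesis
      using eq by (intro exI[of _ "x / form a r"]) (simp add: field_simps eq_neg_iff_add_eq_0)
  qed
  then obtain c where "z = c *s (form a r *s p - form a p *s r)"
    by (auto simp: xy vec.scale_right_diff_distrib)
  then show "z \<in> vec.span {form a r *s p - form a p *s r}"
    by (auto simp: vec.span_singleton)
next
  fix z assume "z \<in> vec.span {form a r *s p - form a p *s r}"
  then obtain c where c: "z = c *s (form a r *s p - form a p *s r)"
    by (auto simp: vec.span_singleton)
  have "z = (c * form a r) *s p + (- c * form a p) *s r"
    by (simp add: c vec.scale_right_diff_distrib)
  then have "z \<in> L"
    using pr unfolding basis2_def by blast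
  then show "z \<in> L \<inter> {x. form a x = 0}"
    by (simp add: c form_scale form_diff)
qed

lemma splash_eq:
  assumes L: "vec.subspace L" and pr: "basis2 L p r"
    and nz: "\<And>a. a \<noteq> 0 \<Longrightarrow> form a p \<noteq> 0 \<or> form a r \<noteq> 0"
  shows "splash emb W (PG L) = (\<lambda>a. vec.span {form a r *s p - form a p *s r}) ` (UNIV - {0})"
proof -
  have "PG L \<inter> PG {x. form a x = 0} = {vec.span {form a r *s p - form a p *s r}}" if "a \<noteq> 0" for a
  proof -
    have "form a r *s p + (- form a p) *s r \<noteq> 0"
      using pr nz[OF that] unfolding basis2_def by (metis neg_equal_0_iff_equal)
    then have "form a r *s p - form a p *s r \<noteq> 0"
      by simp
    then show ?thesis
      using L pr nz[OF that] by (simp add: PG_Int subspace_form_kernel form_kernel_Int PG_span_singleton)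
  qed
  moreover have "splash emb W (PG L) = {P. \<exists>K \<in> proj_span ` sub_hyperplanes emb W. PG L \<inter> K = {P}}"
    by (auto simp: splash_def)
  ultimately show ?thesis
    by (auto simp: sub_hyperplanes_eq)
qed

text \<open>The left side does not mention the basis, so the condition on the right passes from one
  basis of \<open>L\<close> to any other.\<close>

lemma not_in_hyperplane_iff:
  assumes L: "vec.subspace L" and pr: "basis2 L p r"
  shows "(\<forall>H \<in> sub_hyperplanes emb W. \<not> PG L \<subseteq> proj_span H)
    \<longleftrightarrow> (\<forall>a. a \<noteq> 0 \<longrightarrow> form a p \<noteq> 0 \<or> form a r \<noteq> 0)"
proof -
  have "(\<forall>H \<in> sub_hyperplanes emb W. \<not> PG L \<subseteq> proj_span H)
      \<longleftrightarrow> (\<forall>K \<in> proj_span ` sub_hyperplanes emb W. \<not> PG L \<subseteq> K)"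
    by simp
  also have "\<dots> \<longleftrightarrow> (\<forall>a. a \<noteq> 0 \<longrightarrow> \<not> L \<subseteq> {x. form a x = 0})"
    by (simp add: sub_hyperplanes_eq PG_subset_iff[OF L subspace_form_kernel]) (simp add: Ball_def)
  also have "\<dots> \<longleftrightarrow> (\<forall>a. a \<noteq> 0 \<longrightarrow> form a p \<noteq> 0 \<or> form a r \<noteq> 0)"
  proof -
    have "L \<subseteq> {x. form a x = 0} \<longleftrightarrow> form a p = 0 \<and> form a r = 0" for a
    proof
      show "L \<subseteq> {x. form a x = 0} \<Longrightarrow> form a p = 0 \<and> form a r = 0"
        using basis2_memD(1,2)[OF pr] by blast
      show "form a p = 0 \<and> form a r = 0 \<Longrightarrow> L \<subseteq> {x. form a x = 0}"
        using pr by (auto simp: basis2_def form_add form_scale)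
    qed
    then show ?thesis by simp
  qed
  finally show ?thesis .
qed

text \<open>The splash point of \<open>a\<close> has coordinates \<open>form a r\<close> and
  \<open>- form a p\<close>, to be matched with \<open>c\<close> and \<open>c ^ q\<close>. Hence
  \<open>r\<close> plays the part of \<open>u\<close>, and the sign makes \<open>- p\<close> play
  the part of \<open>v\<close>.\<close>

lemma projectivity_image_splash_iff:
  assumes L: "vec.subspace L" and pr: "basis2 L p r"
    and nz: "\<And>a. a \<noteq> 0 \<Longrightarrow> form a p \<noteq> 0 \<or> form a r \<noteq> 0"
    and \<phi>: "\<forall>P \<in> PG UNIV. \<phi> P = pair_map p r ` P"
  shows "\<phi> ` pseudoregulus_model q = splash emb W (PG L) \<longleftrightarrow> nondegenerate r
    \<and> (\<lambda>a. form a (- p) / form a r) ` (UNIV - {0}) = (\<lambda>x. x ^ q / x) ` (UNIV - {0})"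
proof -
  have splash: "splash emb W (PG L) = (\<lambda>a. vec.span {form a r *s p + form a (- p) *s r}) ` (UNIV - {0})"
    using splash_eq[OF L pr] nz by (simp add: form_minus)
  have "\<phi> ` pseudoregulus_model q = splash emb W (PG L) \<longleftrightarrow>
      (\<lambda>a. vec.span {form a r *s p + form a (- p) *s r}) ` (UNIV - {0})
        = (\<lambda>c. vec.span {c *s p + c ^ q *s r}) ` (UNIV - {0})"
    unfolding splash projectivity_image_model[OF \<phi>] by (rule eq_commute)
  also have "\<dots> \<longleftrightarrow> (\<forall>a\<in>UNIV - {0}. form a r \<noteq> 0)
      \<and> (\<lambda>a. form a (- p) / form a r) ` (UNIV - {0}) = (\<lambda>c. c ^ q / c) ` (UNIV - {0})"
    by (rule span_image_ratio_iff[OF pr]) (use nz in \<open>auto simp: form_minus\<close>)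
  also have "(\<forall>a\<in>UNIV - {0}. form a r \<noteq> 0) \<longleftrightarrow> nondegenerate r"
    by (auto simp: nondegenerate_def)
  finally show ?thesis .
qed

end

section \<open>The pointwise stabilizer\<close>

lemma bij_field_embedding:
  fixes \<theta> :: "'a::{field,finite} \<Rightarrow> 'a"
  assumes "field_embedding \<theta>"
  shows "bij \<theta>"
proof -
  have \<theta>: "\<theta> 1 = 1" "\<And>x y. \<theta> (x + y) = \<theta> x + \<theta> y" "\<And>x y. \<theta> (x * y) = \<theta> x * \<theta> y"
    using assms by (auto simp: field_embedding_def)
  have "inj \<theta>"
  proof (rule injI, rule ccontr)
    fix x y assume eq: "\<theta> x = \<theta> y" and "x \<noteq> y"
    have "\<theta> y + \<theta> (x - y) = \<theta> x"
      using \<theta>(2)[of y "x - y"] by simp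
    then have "\<theta> (x - y) = 0"
      using eq by simp
    then have "\<theta> ((x - y) * inverse (x - y)) = 0"
      by (simp add: \<theta>(3))
    then show False
      using \<open>x \<noteq> y\<close> \<theta>(1) by simp
  qed
  then show ?thesis
    by (simp add: bij_def finite_UNIV_inj_surj)
qed

text \<open>Serves to pass from a point fixed by one generator to a point fixed by the
  coordinatewise Frobenius map.\<close>

lemma generate_fixes_point:
  assumes \<sigma>: "\<sigma> \<in> Bij S" "P \<in> S" "\<sigma> P = P" and g: "g \<in> generate (BijGroup S) {\<sigma>}"
  shows "g P = P"
proof -
  have "g \<in> Bij S \<and> g P = P"
    using g
  proof (induction rule: generate.induct)
    case one
    have "\<one>\<^bsub>BijGroup S\<^esub> = (\<lambda>x\<in>S. x)"
      by (simp only: BijGroup_def monoid.simps)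
    then show ?case
      using \<sigma>(2) id_Bij[of S] by (metis restrict_apply')
  next
    case (incl h)
    then show ?case
      using \<sigma> by simp
  next
    case (inv h)
    have "inj_on \<sigma> S"
      using \<sigma>(1) by (simp add: Bij_def bij_betw_def)
    then have "inv_into S \<sigma> P = P"
      using \<sigma> by (metis inv_into_f_f)
    then show ?case
      using inv \<sigma> by (metis inv_BijGroup restrict_inv_into_Bij restrict_apply' singletonD)
  next
    case (eng h1 h2)
    then show ?case
      using \<sigma>(2) by (simp add: BijGroup_def compose_Bij compose_eq)
  qed
  then show ?thesis ..
qed

context finite_field_extension
begin

text \<open>\<open>x ^ q / x\<close> is multiplicative on nonzero elements, and its fibres are the
  cosets of the nonzero elements of the subfield.\<close>

lemma card_ratio_image: "card ((\<lambda>x::'a. x ^ q / x) ` (UNIV - {0})) = (q ^ t - 1) div (q - 1)"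
proof -
  let ?U = "UNIV - {0::'a}" and ?f = "\<lambda>x::'a. x ^ q / x"
  have fibre: "card {x \<in> ?U. ?f x = m} = q - 1" if m: "m \<in> ?f ` ?U" for m
  proof -
    obtain z where "z \<in> ?U" and zm: "m = ?f z"
      using m by (rule imageE)
    then have z: "z \<noteq> 0" "m = ?f z"
      by auto
    have "{x \<in> ?U. ?f x = m} = (\<lambda>k. emb k * z) ` (UNIV - {0})"
    proof (intro equalityI subsetI)
      fix x assume "x \<in> {x \<in> ?U. ?f x = m}"
      then have "x \<noteq> 0" "(x / z) ^ q = x / z"
        using z by (auto simp: field_simps)
      then obtain k where "x / z = emb k"
        using power_q_eq_self_iff[of "x / z"] by auto
      then have "x = emb k * z" "k \<noteq> 0"
        using z \<open>x \<noteq> 0\<close> by (auto simp: field_simps)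
      then show "x \<in> (\<lambda>k. emb k * z) ` (UNIV - {0})"
        by blast
    qed (use z in \<open>auto simp: power_mult_distrib emb_power_q\<close>)
    moreover have "inj_on (\<lambda>k. emb k * z) (UNIV - {0})"
      using z(1) inj_emb by (auto simp: inj_on_def)
    ultimately show ?thesis
      by (simp add: card_image card_Diff_singleton card_k)
  qed
  have "card ?U = (\<Sum>m\<in>?f ` ?U. card {x \<in> ?U. ?f x = m})"
    using sum.image_gen[of ?U "\<lambda>_. 1::nat" ?f] by simp
  also have "\<dots> = (\<Sum>m\<in>?f ` ?U. q - 1)"
    by (intro sum.cong refl fibre)
  also have "\<dots> = card (?f ` ?U) * (q - 1)"
    by simp
  finally show ?thesis
    using q_ge_2 by (simp add: card_Diff_singleton card_a)
qed

end

section \<open>Collineations induced by automorphisms of the field\<close>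

context canonical_frame
begin

definition galois :: "('a \<Rightarrow> 'a) \<Rightarrow> bool" where
  "galois \<theta> \<longleftrightarrow> field_embedding \<theta> \<and> (\<forall>k. \<theta> (emb k) = emb k)"

definition coll :: "('a \<Rightarrow> 'a) \<Rightarrow> ('a ^ 'n) set \<Rightarrow> ('a ^ 'n) set" where
  "coll \<theta> = restrict (\<lambda>P. semilin \<theta> ` P) (PG UNIV)"

abbreviation Fr :: "nat \<Rightarrow> ('a ^ 'n) set \<Rightarrow> ('a ^ 'n) set" where
  "Fr s \<equiv> coll (\<lambda>x. x ^ (q ^ s))"

abbreviation PGroup :: "(('a ^ 'n) set \<Rightarrow> ('a ^ 'n) set) monoid" where
  "PGroup \<equiv> BijGroup (PG UNIV)"

lemma galois_frob: "galois (\<lambda>x. x ^ (q ^ s))"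
  by (simp add: galois_def field_embedding_frob frob_emb)

lemma bij_semilin:
  assumes "field_embedding \<theta>"
  shows "bij (semilin \<theta>)"
proof -
  have "inj (semilin \<theta>)"
  proof (rule injI)
    fix x y assume "semilin \<theta> x = semilin \<theta> y"
    then have "coord (semilin \<theta> x) = coord (semilin \<theta> y)"
      by simp
    then have "coord x = coord y"
      using bij_field_embedding[OF assms] by (simp add: semilin_def vec_eq_iff bij_is_inj inj_eq)
    then show "x = y"
      by (simp add: coord_eq_iff)
  qed
  then show ?thesis
    by (simp add: bij_def finite_UNIV_inj_surj)
qed

lemma semilin_eq_0_iff:
  assumes "field_embedding \<theta>"
  shows "semilin \<theta> x = 0 \<longleftrightarrow> x = 0"
proof -
  have "semilin \<theta> 0 = 0"
    using semilin_add[OF assms, of 0 0] by simp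
  then show ?thesis
    using bij_semilin[OF assms] by (metis bij_is_inj injD)
qed

lemma semilin_image_span:
  assumes "field_embedding \<theta>"
  shows "semilin \<theta> ` vec.span {x} = vec.span {semilin \<theta> x}"
proof -
  have "semilin \<theta> ` vec.span {x} = (\<lambda>c. c *s semilin \<theta> x) ` range \<theta>"
    by (simp add: vec.span_singleton image_image semilin_scale[OF assms])
  then show ?thesis
    using bij_is_surj[OF bij_field_embedding[OF assms]] by (simp add: vec.span_singleton)
qed

lemma coll_span:
  assumes "field_embedding \<theta>" "x \<noteq> 0"
  shows "coll \<theta> (vec.span {x}) = vec.span {semilin \<theta> x}"
proof -
  have "vec.span {x} \<in> PG UNIV"
    using assms(2) by (auto simp: PG_def)
  then show ?thesis
    by (simp add: coll_def semilin_image_span[OF assms(1)])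
qed

lemma coll_closed:
  assumes "field_embedding \<theta>" "P \<in> PG UNIV"
  shows "coll \<theta> P \<in> PG UNIV"
proof -
  obtain x where "P = vec.span {x}" "x \<noteq> 0"
    using assms(2) by (auto simp: PG_def)
  then show ?thesis
    using assms(1) by (auto simp: coll_span PG_def semilin_eq_0_iff)
qed

lemma coll_Bij:
  assumes "field_embedding \<theta>"
  shows "coll \<theta> \<in> Bij (PG UNIV)"
proof -
  have "inj_on (coll \<theta>) (PG UNIV)"
    using bij_is_inj[OF bij_semilin[OF assms]] by (auto simp: inj_on_def coll_def inj_image_eq_iff)
  moreover have "coll \<theta> ` PG UNIV = PG UNIV"
    by (rule endo_inj_surj) (use calculation coll_closed[OF assms] in auto)
  ultimately show ?thesis
    by (simp add: Bij_def bij_betw_def) (simp add: coll_def)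
qed

lemma coll_mult:
  assumes "field_embedding \<theta>" "field_embedding \<eta>"
  shows "coll \<theta> \<otimes>\<^bsub>PGroup\<^esub> coll \<eta> = coll (\<lambda>x. \<theta> (\<eta> x))"
proof -
  have "coll \<theta> (coll \<eta> P) = coll (\<lambda>x. \<theta> (\<eta> x)) P" if "P \<in> PG UNIV" for P
    using that coll_closed[OF assms(2) that] by (simp add: coll_def image_image semilin_compose)
  then show ?thesis
    using assms by (auto simp: BijGroup_def coll_Bij compose_def coll_def[of "\<lambda>x. \<theta> (\<eta> x)"] fun_eq_iff)
qed

lemma Fr_mult: "Fr i \<otimes>\<^bsub>PGroup\<^esub> Fr j = Fr (i + j)"
proof -
  have "(\<lambda>x::'a. (x ^ (q ^ j)) ^ (q ^ i)) = (\<lambda>x. x ^ (q ^ (i + j)))"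
    by (simp add: frob_compose frob_mod add.commute)
  then show ?thesis
    by (simp add: coll_mult field_embedding_frob)
qed

lemma Fr_cong: "i mod t = j mod t \<Longrightarrow> Fr i = Fr j"
  by (metis frob_mod)

lemma Fr_0: "Fr 0 = \<one>\<^bsub>PGroup\<^esub>"
  by (simp add: coll_def BijGroup_def semilin_def)

lemma Fr_carrier: "Fr s \<in> carrier PGroup"
  using coll_Bij[OF field_embedding_frob] by (simp add: BijGroup_def)

lemma inv_Fr:
  assumes "(i + j) mod t = 0"
  shows "inv\<^bsub>PGroup\<^esub> (Fr i) = Fr j"
proof (rule group.inv_equality[OF group_BijGroup])
  have "Fr (j + i) = Fr 0"
    by (rule Fr_cong) (use assms in \<open>simp add: add.commute\<close>)
  then show "Fr j \<otimes>\<^bsub>PGroup\<^esub> Fr i = \<one>\<^bsub>PGroup\<^esub>"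
    by (simp only: Fr_mult Fr_0)
qed (rule Fr_carrier)+

lemma coll_in_stabilizer:
  assumes "galois \<theta>"
  shows "coll \<theta> \<in> pointwise_stabilizer (PG W)"
proof -
  have \<theta>: "field_embedding \<theta>" "\<And>k. \<theta> (emb k) = emb k"
    using assms by (auto simp: galois_def)
  have "semilinear \<theta> (semilin \<theta>)"
    by (simp add: semilinear_def semilin_add[OF \<theta>(1)] semilin_scale[OF \<theta>(1)])
  then have "coll \<theta> \<in> PGammaL"
    unfolding PGammaL_def coll_def using \<theta>(1) bij_semilin[OF \<theta>(1)] bij_field_embedding[OF \<theta>(1)] by blast
  moreover have "coll \<theta> P = P" if P: "P \<in> PG W" for P
  proof -
    obtain x where "P = vec.span {x}" "x \<in> W" "x \<noteq> 0"
      using P by (auto simp: PG_def)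
    then show ?thesis
      using \<theta> by (simp add: coll_span semilin_W)
  qed
  ultimately show ?thesis
    by (simp add: pointwise_stabilizer_def)
qed

text \<open>On \<open>W\<close> the semilinear map \<open>f\<close> multiplies every vector by some
  scalar. Comparing two frame vectors with the vectors \<open>frame i0 + emb l *s frame i\<close>
  shows that all frame vectors have the same scalar \<open>d\<close> and that
  \<open>\<theta>\<close> fixes the subfield. So \<open>f\<close> is \<open>d\<close> times a
  coordinatewise map, and \<open>d\<close> is invisible on points.\<close>

lemma stabilizer_imp_coll:
  assumes "g \<in> pointwise_stabilizer (PG W)"
  obtains \<theta> where "galois \<theta>" "g = coll \<theta>"
proof -
  obtain f \<theta> where f: "g = restrict (\<lambda>P. f ` P) (PG UNIV)" "field_embedding \<theta>" "semilinear \<theta> f"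
    using assms by (auto simp: pointwise_stabilizer_def PGammaL_def)
  have f_add: "f (x + y) = f x + f y" and f_scale: "f (c *s x) = \<theta> c *s f x" for x y c
    using f(3) by (auto simp: semilinear_def)
  have f_0: "f 0 = 0"
    using f_add[of 0 0] by simp
  have f_span: "f ` vec.span {x} = vec.span {f x}" for x
  proof -
    have "f ` vec.span {x} = (\<lambda>c. c *s f x) ` range \<theta>"
      by (simp add: vec.span_singleton image_image f_scale)
    then show ?thesis
      using bij_is_surj[OF bij_field_embedding[OF f(2)]] by (simp add: vec.span_singleton)
  qed
  have fixed: "\<exists>c. c \<noteq> 0 \<and> f x = c *s x" if x: "x \<in> W" "x \<noteq> 0" for x
  proof -
    have "vec.span {x} \<in> PG W" "vec.span {x} \<in> PG UNIV"
      using x by (auto simp: PG_def)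
    then have "g (vec.span {x}) = vec.span {f x}"
      by (simp add: f(1) f_span)
    moreover have "g (vec.span {x}) = vec.span {x}"
      using assms \<open>vec.span {x} \<in> PG W\<close> unfolding pointwise_stabilizer_def by blast
    ultimately have "vec.span {x} = vec.span {f x}"
      by simp
    then show ?thesis
      using x(2) by (simp add: span_singleton_eq_iff)
  qed
  have frame_coord: "coord (frame i) $ j = (if i = j then 1 else 0)" for i j
    by (simp add: frame_def axis_def)
  have ne: "frame i \<noteq> 0" for i
    using frame_coord[of i i] by auto
  have W_add: "x + y \<in> W" if "x \<in> W" "y \<in> W" for x y
    using subspace_W that by (rule k.subspace_add)
  \<comment> \<open>An arbitrary index, fixed for reference.\<close>
  define i0 where "i0 = (undefined :: 'n)"
  obtain d where d: "d \<noteq> 0" "f (frame i0) = d *s frame i0"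
    using fixed[OF frame_in_W ne] by blast
  have key: "f (frame i) = d *s frame i \<and> \<theta> (emb k) = emb k" if "i \<noteq> i0" for i k
  proof -
    obtain c where c: "f (frame i) = c *s frame i"
      using fixed[OF frame_in_W ne] by blast
    have eq: "d = c' \<and> \<theta> (emb l) * c = c' * emb l"
      if c': "f (frame i0 + emb l *s frame i) = c' *s (frame i0 + emb l *s frame i)" for c' l
    proof -
      have "d *s frame i0 + (\<theta> (emb l) * c) *s frame i = c' *s frame i0 + (c' * emb l) *s frame i"
        using c' by (simp add: f_add f_scale d(2) c vec.scale_right_distrib)
      then have "coord (d *s frame i0 + (\<theta> (emb l) * c) *s frame i) $ j
          = coord (c' *s frame i0 + (c' * emb l) *s frame i) $ j" for j
        by simp
      from this[of i0] this[of i] show ?thesis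
        using that \<open>i \<noteq> i0\<close> by (simp add: coord_add coord_scale frame_coord)
    qed
    have ex: "\<exists>c'. f (frame i0 + emb l *s frame i) = c' *s (frame i0 + emb l *s frame i)" for l
    proof -
      have "kscale emb l (frame i) \<in> W"
        using subspace_W frame_in_W by (rule k.subspace_scale)
      then have "frame i0 + emb l *s frame i \<in> W"
        using W_add[OF frame_in_W] by (simp add: kscale_def)
      moreover have "coord (frame i0 + emb l *s frame i) $ i0 = 1"
        using \<open>i \<noteq> i0\<close> by (simp add: coord_add coord_scale frame_coord)
      then have "frame i0 + emb l *s frame i \<noteq> 0"
        by auto
      ultimately show ?thesis
        using fixed by blast
    qed
    have "\<theta> 1 = 1"
      using f(2) by (simp add: field_embedding_def)
    moreover have eq': "\<theta> (emb l) * c = d * emb l" for l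
      using ex[of l] eq[of l] by blast
    ultimately have "c = d"
      using eq'[of 1] by simp
    moreover have "\<theta> (emb k) = emb k"
      using eq'[of k] \<open>c = d\<close> d(1) by simp
    ultimately show ?thesis
      using c by simp
  qed
  \<comment> \<open>A second index is needed, because \<open>key\<close> speaks of the subfield only
    for indices other than \<open>i0\<close>.\<close>
  have "CARD('n) \<noteq> 1"
    using card_n t_ge_3 by simp
  then obtain i1 :: 'n where "i1 \<noteq> i0"
    by (metis (full_types) UNIV_eq_I card_1_singleton_iff is_singletonI is_singleton_altdef singletonI)
  then have "\<theta> (emb k) = emb k" for k
    using key by blast
  then have \<theta>: "galois \<theta>"
    using f(2) by (simp add: galois_def)
  have frame: "f (frame i) = d *s frame i" for i
    using key d(2) by (cases "i = i0") auto
  have f_sum: "f (\<Sum>i\<in>I. h i) = (\<Sum>i\<in>I. f (h i))" for I and h :: "'n \<Rightarrow> 'a ^ 'n"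
    by (induction I rule: infinite_finite_induct) (auto simp: f_0 f_add)
  have "f x = d *s semilin \<theta> x" for x
  proof -
    have "f x = (\<Sum>i\<in>UNIV. f (coord x $ i *s frame i))"
      by (subst frame_expand) (rule f_sum)
    also have "\<dots> = d *s (\<Sum>i\<in>UNIV. \<theta> (coord x $ i) *s frame i)"
      by (simp add: f_scale frame vec.scale_sum_right mult.commute)
    also have "(\<Sum>i\<in>UNIV. \<theta> (coord x $ i) *s frame i) = semilin \<theta> x"
      by (subst (2) frame_expand) (simp add: semilin_def)
    finally show ?thesis .
  qed
  then have "f ` vec.span {x} = semilin \<theta> ` vec.span {x}" for x
    by (simp only: f_span semilin_image_span[OF f(2)] span_singleton_scale[OF d(1)])
  then have f_P: "f ` P = semilin \<theta> ` P" if "P \<in> PG UNIV" for P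
    using that unfolding PG_def by blast
  have "g = coll \<theta>"
    unfolding f(1) coll_def by (rule restrict_ext) (rule f_P)
  with \<theta> show ?thesis
    by (rule that)
qed

lemma Fr_inject:
  assumes u: "nondegenerate u" and eq: "Fr i = Fr j"
  shows "i mod t = j mod t"
proof (rule ccontr)
  assume neq: "i mod t \<noteq> j mod t"
  have "(\<chi> i. 1) \<noteq> (0 :: 'k ^ 'n)"
    by (simp add: vec_eq_iff)
  then have "form (\<chi> i. 1) u \<noteq> 0"
    using u by (simp add: nondegenerate_def)
  then have "u \<noteq> 0"
    by auto
  then have "vec.span {Frob i u} = vec.span {Frob j u}" "Frob i u \<noteq> 0"
    using fun_cong[OF eq, of "vec.span {u}"] by (auto simp: coll_span field_embedding_frob semilin_eq_0_iff)
  then obtain c where "Frob j u = c *s Frob i u"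
    by (auto simp: span_singleton_eq_iff)
  then have "1 *s Frob j u + 0 *s Frob i u = c *s Frob i u + 0 *s Frob i u"
    by simp
  from Frob_coeff_eq_0[OF u this] show False
    using neq by simp
qed

lemma stabilizer_eq:
  assumes u: "nondegenerate u"
  shows "pointwise_stabilizer (PG W) = range Fr"
proof (intro equalityI subsetI)
  fix g assume "g \<in> pointwise_stabilizer (PG W)"
  then obtain \<theta> where \<theta>: "galois \<theta>" "g = coll \<theta>"
    by (rule stabilizer_imp_coll)
  then obtain s where "\<theta> = (\<lambda>x. x ^ (q ^ s))"
    using embedding_eq_frob[OF _ _ u, of \<theta>] by (auto simp: galois_def)
  then show "g \<in> range Fr"
    using \<theta>(2) by blast
qed (use coll_in_stabilizer[OF galois_frob] in auto)

text \<open>The exponents of \<open>Fr\<close> compose like residues modulo \<open>t\<close>, and a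
  residue generates the cyclic group exactly if it is invertible.\<close>

lemma stabilizer_generator_Fr_iff:
  assumes u: "nondegenerate u"
  shows "stabilizer_generator (PG W) (Fr s) \<longleftrightarrow> coprime s t"
proof -
  have multiple: "Fr (k * s) \<in> generate PGroup {Fr s}" for k
  proof (induction k)
    case 0
    then show ?case
      using generate.one[of PGroup] by (simp only: mult_0 Fr_0)
  next
    case (Suc k)
    then have "Fr s \<otimes>\<^bsub>PGroup\<^esub> Fr (k * s) \<in> generate PGroup {Fr s}"
      by (intro generate.eng[OF generate.incl[OF singletonI]])
    then show ?case
      by (simp only: Fr_mult mult_Suc)
  qed
  have "\<exists>k. g = Fr (k * s)" if "g \<in> generate PGroup {Fr s}" for g
    using that
  proof (induction rule: generate.induct)
    case one
    show ?case
      by (rule exI[of _ 0]) (simp only: mult_0 Fr_0)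
  next
    case (incl h)
    then show ?case
      by (intro exI[of _ 1]) simp
  next
    case (inv h)
    have "s + (t - 1) * s = t * s"
      using t_ge_3 by (cases t) auto
    then have "(s + (t - 1) * s) mod t = 0"
      by simp
    then have "inv\<^bsub>PGroup\<^esub> (Fr s) = Fr ((t - 1) * s)"
      by (rule inv_Fr)
    then show ?case
      using inv by blast
  next
    case (eng h1 h2)
    then obtain k1 k2 where "h1 = Fr (k1 * s)" "h2 = Fr (k2 * s)"
      by blast
    then have "h1 \<otimes>\<^bsub>PGroup\<^esub> h2 = Fr ((k1 + k2) * s)"
      by (simp only: Fr_mult add_mult_distrib)
    then show ?case by blast
  qed
  then have generate: "generate PGroup {Fr s} = range (\<lambda>k. Fr (k * s))"
    using multiple by auto
  have "stabilizer_generator (PG W) (Fr s) \<longleftrightarrow> range (\<lambda>k. Fr (k * s)) = range Fr"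
    by (simp add: stabilizer_generator_def stabilizer_eq[OF u] generate)
  also have "\<dots> \<longleftrightarrow> coprime s t"
  proof
    assume "range (\<lambda>k. Fr (k * s)) = range Fr"
    then have "Fr 1 \<in> range (\<lambda>k. Fr (k * s))"
      by (metis rangeI)
    then obtain k where "Fr 1 = Fr (k * s)"
      by blast
    then have "1 mod t = (k * s) mod t"
      by (rule Fr_inject[OF u])
    then have "[s * k = Suc 0] (mod t)"
      by (simp add: unique_euclidean_semiring_class.cong_def mult.commute)
    then show "coprime s t"
      using coprime_iff_invertible_nat by blast
  next
    assume "coprime s t"
    then obtain k where k: "[s * k = Suc 0] (mod t)"
      using coprime_iff_invertible_nat by blast
    have "Fr j = Fr (j * k * s)" for j
    proof (rule Fr_cong)
      show "j mod t = (j * k * s) mod t"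
        using cong_scalar_left[OF k, of j]
        by (simp add: unique_euclidean_semiring_class.cong_def ac_simps)
    qed
    then show "range (\<lambda>k. Fr (k * s)) = range Fr"
      by (intro equalityI image_subsetI rangeI) (metis rangeI)
  qed
  finally show ?thesis .
qed

text \<open>A number dividing \<open>2 * s\<close> and coprime to \<open>s\<close> divides 2, too
  small for \<open>t\<close>. In terms of collineations, a generator is not its own inverse.\<close>

lemma double_mod_neq_0:
  assumes s: "coprime s t"
  shows "(s + s) mod t \<noteq> 0"
proof
  assume "(s + s) mod t = 0"
  then have "t dvd 2 * s"
    by (simp add: mult_2 mod_eq_0_iff_dvd)
  then have "t dvd 2"
    using s by (simp add: coprime_dvd_mult_left_iff coprime_commute)
  then show False
    using t_ge_3 by (auto dest: dvd_imp_le)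
qed

text \<open>Write \<open>r\<close> in the basis \<open>u\<close>, \<open>Frob s u\<close> and apply
  \<open>Frob s'\<close>. The result involves the conjugates with indices \<open>s'\<close> and
  \<open>s' + s\<close> but must lie in the span of those with indices 0 and \<open>s\<close>.
  Independence leaves \<open>s' = s\<close> with \<open>r\<close> a multiple of \<open>u\<close>, or
  \<open>s' = - s\<close> with \<open>r\<close> a multiple of \<open>Frob s u\<close>, modulo
  \<open>t\<close>.\<close>

lemma transversal_pair_unique:
  assumes u: "nondegenerate u" and s: "coprime s t" and s': "coprime s' t"
    and uv: "basis2 L u (Frob s u)" and r: "r \<in> L" "r \<noteq> 0" "Frob s' r \<in> L"
  shows "s' mod t = s mod t \<and> vec.span {r} = vec.span {u}
        \<and> vec.span {Frob s' r} = vec.span {Frob s u}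
    \<or> (s + s') mod t = 0 \<and> vec.span {r} = vec.span {Frob s u}
        \<and> vec.span {Frob s' r} = vec.span {u}"
proof -
  have ndvd: "\<not> t dvd n" if "coprime n t" for n
    using that t_ge_3 by (metis coprime_absorb_right is_unit_gcd nat_dvd_1_iff_1 numeral_eq_one_iff
        numeral_le_one_iff semiring_norm(70))
  have s0: "s mod t \<noteq> 0" "s' mod t \<noteq> 0"
    using ndvd s s' by (auto simp: mod_eq_0_iff_dvd)
  have add_mod: "(a + b) mod t = a mod t \<longleftrightarrow> b mod t = 0" for a b
    using cong_add_lcancel_0_nat[of a b t] by (simp add: unique_euclidean_semiring_class.cong_def)
  have ne_s: "(s' + s) mod t \<noteq> s mod t" and ne_s': "(s' + s) mod t \<noteq> s' mod t"
    using s0 add_mod[of s s'] add_mod[of s' s] by (auto simp: add.commute)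
  have ss: "(s + s) mod t \<noteq> 0"
    by (rule double_mod_neq_0[OF s])
  obtain \<alpha> \<beta> where \<alpha>\<beta>: "r = \<alpha> *s u + \<beta> *s Frob s u"
    using uv r(1) by (auto simp: basis2_def)
  obtain \<gamma> \<delta> where "Frob s' r = \<gamma> *s u + \<delta> *s Frob s u"
    using uv r(3) by (auto simp: basis2_def)
  moreover have Frob_0: "Frob 0 u = u"
    by (simp add: semilin_def)
  moreover have Frob_r: "Frob s' r = \<alpha> ^ (q ^ s') *s Frob s' u + \<beta> ^ (q ^ s') *s Frob (s' + s) u"
    unfolding \<alpha>\<beta> Frob_add Frob_scale Frob_compose Frob_mod ..
  ultimately have eq: "\<alpha> ^ (q ^ s') *s Frob s' u + \<beta> ^ (q ^ s') *s Frob (s' + s) u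
      = \<gamma> *s Frob 0 u + \<delta> *s Frob s u"
    by simp
  \<comment> \<open>The same relation with its left side swapped, as coefficient comparison reads
    off the leading summand.\<close>
  have eq': "\<beta> ^ (q ^ s') *s Frob (s' + s) u + \<alpha> ^ (q ^ s') *s Frob s' u
      = \<gamma> *s Frob 0 u + \<delta> *s Frob s u"
    using eq by (simp add: add.commute)
  show ?thesis
  proof (cases "\<alpha> = 0")
    case False
    then have "s' mod t = s mod t"
      using Frob_coeff_eq_0[OF u eq] ne_s' s0 by auto
    then have "(s' + s) mod t = (s + s) mod t"
      by (metis mod_add_cong)
    then have "\<beta> = 0"
      using Frob_coeff_eq_0[OF u eq'] ne_s ne_s' ss by auto
    have "Frob s' r = \<alpha> ^ (q ^ s') *s Frob s u"
      using Frob_r \<open>\<beta> = 0\<close> \<open>s' mod t = s mod t\<close> Frob_mod[of s' u] Frob_mod[of s u] q_ge_2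
      by (simp add: zero_power)
    then show ?thesis
      using \<open>s' mod t = s mod t\<close> False \<open>\<beta> = 0\<close> \<alpha>\<beta> by (simp add: span_singleton_scale)
  next
    case True
    then have "\<beta> \<noteq> 0"
      using r(2) \<alpha>\<beta> by auto
    then have "(s' + s) mod t = 0"
      using Frob_coeff_eq_0[OF u eq'] ne_s ne_s' by auto
    moreover have "Frob (s' + s) u = u"
      using calculation Frob_mod[of "s' + s" u] Frob_0 by simp
    then have "Frob s' r = \<beta> ^ (q ^ s') *s u"
      using Frob_r True q_ge_2 by (simp add: zero_power)
    ultimately show ?thesis
      using True \<open>\<beta> \<noteq> 0\<close> \<alpha>\<beta> by (simp add: span_singleton_scale add.commute)
  qed
qed

text \<open>The representatives \<open>form a r *s p - form a p *s r\<close> of the splash points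
  depend on \<open>a\<close> linearly over the small field and injectively, so they form a subspace
  of dimension \<open>t\<close>.\<close>

lemma linear_set_splash:
  assumes L: "vec.subspace L" and pr: "basis2 L p r"
    and nz: "\<And>a. a \<noteq> 0 \<Longrightarrow> form a p \<noteq> 0 \<or> form a r \<noteq> 0"
  shows "linear_set emb L t (splash emb W (PG L))"
proof -
  define w where "w a = form a r *s p - form a p *s r" for a
  have w_add: "w (a + b) = w a + w b" and w_scale: "w (k *s a) = kscale emb k (w a)"
    and w_diff: "w (a - b) = w a - w b" for a b k
    by (simp_all add: w_def form_add_left form_diff_left form_scale_left kscale_def
        vec.scale_left_distrib vec.scale_left_diff_distrib vec.scale_right_diff_distrib)
  have w_0: "w 0 = 0"
    by (simp add: w_def)
  have w_eq: "w a = form a r *s p + (- form a p) *s r" for a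
    by (simp add: w_def)
  have w_ne: "w a \<noteq> 0" if "a \<noteq> 0" for a
    using pr nz[OF that] unfolding basis2_def w_eq by (metis neg_equal_0_iff_equal)
  have w_L: "w a \<in> L" for a
    using pr unfolding basis2_def w_eq by blast
  have U: "k.subspace (range w)"
    unfolding k.subspace_def by (metis (no_types, lifting) rangeE rangeI w_0 w_add w_scale)
  have "inj w"
  proof (rule injI)
    fix a b assume "w a = w b"
    then have "w (a - b) = 0"
      by (simp add: w_diff)
    then show "a = b"
      using w_ne[of "a - b"] by auto
  qed
  then have "card (range w) = q ^ t"
    by (simp add: card_image card_k card_n)
  then have dim: "k.dim (range w) = t"
    using card_ksubspace[OF U] q_ge_2 by simp
  have "splash emb W (PG L) = (\<lambda>a. vec.span {w a}) ` (UNIV - {0})"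
    unfolding w_def by (rule splash_eq[OF L pr nz])
  also have "\<dots> = {P \<in> PG L. PGk emb P \<inter> PGk emb (range w) \<noteq> {}}"
  proof (intro equalityI subsetI)
    fix P assume "P \<in> (\<lambda>a. vec.span {w a}) ` (UNIV - {0})"
    then obtain a where a: "a \<noteq> 0" "P = vec.span {w a}"
      by blast
    then have "w a \<in> P" "w a \<noteq> 0"
      using w_ne by (auto simp: vec.span_base)
    then have "kspan emb {w a} \<in> PGk emb P \<inter> PGk emb (range w)"
      unfolding PGk_def by blast
    moreover have "P \<in> PG L"
      using a w_ne w_L by (auto simp: PG_def)
    ultimately show "P \<in> {P \<in> PG L. PGk emb P \<inter> PGk emb (range w) \<noteq> {}}"
      by blast
  next
    fix P assume "P \<in> {P \<in> PG L. PGk emb P \<inter> PGk emb (range w) \<noteq> {}}"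
    then obtain y x a where P: "P = vec.span {y}" and x: "x \<in> P" and a: "w a \<noteq> 0"
        and eq: "k.span {x} = k.span {w a}"
      by (auto simp: PG_def PGk_def)
    have "w a \<in> k.span {x}"
      unfolding eq by (rule k.span_base) simp
    then obtain c where "w a = emb c *s x"
      by (auto simp: k.span_singleton kscale_def)
    moreover obtain e where "x = e *s y"
      using x P by (auto simp: vec.span_singleton)
    ultimately obtain d where "w a = d *s y"
      using that[of "emb c * e"] by simp
    then have "P = vec.span {w a}"
      using a P span_singleton_scale[of d y] by auto
    moreover have "a \<noteq> 0"
      using a w_0 by auto
    ultimately show "P \<in> (\<lambda>a. vec.span {w a}) ` (UNIV - {0})"
      by blast
  qed
  finally have "splash emb W (PG L) = {P \<in> PG L. PGk emb P \<inter> PGk emb (range w) \<noteq> {}}" .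
  moreover have "range w \<subseteq> L"
    using w_L by blast
  ultimately show ?thesis
    unfolding linear_set_def using U dim by (intro exI[of _ "range w"] conjI)
qed

end

section \<open>Splashes of pseudoregulus type\<close>

context canonical_frame
begin

lemma splash_eq_model_imp_Frob:
  assumes L: "vec.subspace L" and pr: "basis2 L p r"
    and nz: "\<And>a. a \<noteq> 0 \<Longrightarrow> form a p \<noteq> 0 \<or> form a r \<noteq> 0"
    and \<phi>: "\<forall>P \<in> PG UNIV. \<phi> P = pair_map p r ` P"
    and eq: "\<phi> ` pseudoregulus_model q = splash emb W (PG L)"
  obtains s where "nondegenerate r" "coprime s t" "Frob s r \<in> L" "vec.span {p} = vec.span {Frob s r}"
proof -
  have "nondegenerate r
      \<and> (\<lambda>a. form a (- p) / form a r) ` (UNIV - {0}) = (\<lambda>x. x ^ q / x) ` (UNIV - {0})"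
    by (rule iffD1[OF projectivity_image_splash_iff[OF L pr _ \<phi>] eq]) (rule nz)
  then have r: "nondegenerate r"
    and ratio: "(\<lambda>a. form a (- p) / form a r) ` (UNIV - {0}) = (\<lambda>x. x ^ q / x) ` (UNIV - {0})"
    by (rule conjunct1, rule conjunct2)
  obtain s c where sc: "coprime s t" "c \<noteq> 0" "- p = c *s Frob s r"
    using Frob_if_ratio_image_eq[OF r ratio] by blast
  have p: "p = (- c) *s Frob s r"
    using sc(3) by (metis minus_minus vec.scale_minus_left)
  have "Frob s r = (- 1 / c) *s p"
    using sc(2) by (simp add: p)
  then have "Frob s r \<in> L"
    using basis2_memD(1)[OF pr] L by (metis vec.subspace_scale)
  moreover have "vec.span {p} = vec.span {Frob s r}"
    unfolding p by (rule span_singleton_scale) (use sc(2) in simp)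
  ultimately show ?thesis
    using that r sc(1) by blast
qed

text \<open>The points of the model correspond to the ratios \<open>c ^ q / c\<close>, whose number
  is the one required of a scattered linear set of rank \<open>t\<close>.\<close>

lemma scattered_if_splash_eq_model:
  assumes L: "vec.subspace L" and pr: "basis2 L p r"
    and nz: "\<And>a. a \<noteq> 0 \<Longrightarrow> form a p \<noteq> 0 \<or> form a r \<noteq> 0"
    and \<phi>: "\<forall>P \<in> PG UNIV. \<phi> P = pair_map p r ` P"
    and eq: "\<phi> ` pseudoregulus_model q = splash emb W (PG L)"
  shows "scattered_linear_set emb L (splash emb W (PG L))"
proof -
  have "splash emb W (PG L) = (\<lambda>c. vec.span {c *s p + c ^ q *s r}) ` (UNIV - {0})"
    using eq projectivity_image_model[OF \<phi>] by simp
  also have "\<dots> = (\<lambda>m. vec.span {p + m *s r}) ` (\<lambda>c. c ^ q / c) ` (UNIV - {0})"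
    unfolding image_image
  proof (rule image_cong)
    fix c :: 'a assume "c \<in> UNIV - {0}"
    then have "c \<noteq> 0" by simp
    then have "c *s p + c ^ q *s r = c *s (p + (c ^ q / c) *s r)"
      by (simp add: vec.scale_right_distrib)
    then show "vec.span {c *s p + c ^ q *s r} = vec.span {p + (c ^ q / c) *s r}"
      using span_singleton_scale[OF \<open>c \<noteq> 0\<close>] by metis
  qed simp
  finally have "card (splash emb W (PG L)) = (q ^ t - 1) div (q - 1)"
    using card_image[OF inj_on_subset[OF inj_span_affine[OF pr] subset_UNIV]]
    by (simp only: card_ratio_image)
  moreover have "linear_set emb L t (splash emb W (PG L))"
    by (rule linear_set_splash[OF L pr]) (rule nz)
  ultimately show ?thesis
    unfolding scattered_linear_set_def card_k using t_ge_3 by (intro exI[of _ t]) auto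
qed

text \<open>A common point of the line and its image under \<open>Fr i\<close> comes from some
  \<open>x\<close> with both \<open>x\<close> and \<open>Frob i x\<close> in \<open>L\<close>. For
  \<open>i = s\<close> and for \<open>i = - s\<close> modulo \<open>t\<close>, exactly one
  alternative of \<open>transversal_pair_unique\<close> survives, since \<open>s\<close> and
  \<open>- s\<close> are incongruent.\<close>

lemma line_meets_image:
  assumes L: "vec.subspace L" and u: "nondegenerate u" and s: "coprime s t"
    and uv: "basis2 L u (Frob s u)"
  shows "PG L \<inter> Fr s ` PG L = {vec.span {Frob s u}}"
    and "PG L \<inter> (inv\<^bsub>PGroup\<^esub> (Fr s)) ` PG L = {vec.span {u}}"
proof -
  have ss: "(s + s) mod t \<noteq> 0"
    by (rule double_mod_neq_0[OF s])
  have u0: "u \<in> L" "Frob s u \<in> L" "u \<noteq> 0" "Frob s u \<noteq> 0"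
    using basis2_memD[OF uv] by auto
  have Fr_span: "Fr i (vec.span {x}) = vec.span {Frob i x}" if "x \<noteq> 0" for i x
    by (rule coll_span[OF field_embedding_frob that])
  have mem: "vec.span {u} \<in> PG L" "vec.span {Frob s u} \<in> PG L"
    using u0 by (auto simp: PG_def)
  have meet: "\<exists>x. x \<in> L \<and> x \<noteq> 0 \<and> Frob i x \<in> L \<and> P = vec.span {Frob i x}"
    if P: "P \<in> PG L \<inter> Fr i ` PG L" for P i
  proof -
    obtain x where x: "x \<in> L" "x \<noteq> 0" "P = Fr i (vec.span {x})"
      using P by (auto simp: PG_def)
    have "Frob i x \<noteq> 0"
      using x(2) by (simp add: semilin_eq_0_iff field_embedding_frob)
    then have "Frob i x \<in> L"
      using P span_singleton_in_PG_iff[OF L] by (simp add: x(3) Fr_span[OF x(2)])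
    then show ?thesis
      using x Fr_span by blast
  qed
  show "PG L \<inter> Fr s ` PG L = {vec.span {Frob s u}}"
  proof (intro equalityI subsetI)
    fix P assume "P \<in> PG L \<inter> Fr s ` PG L"
    then obtain x where x: "x \<in> L" "x \<noteq> 0" "Frob s x \<in> L" "P = vec.span {Frob s x}"
      using meet by blast
    then show "P \<in> {vec.span {Frob s u}}"
      using transversal_pair_unique[OF u s s uv x(1-3)] ss by simp
  next
    fix P assume "P \<in> {vec.span {Frob s u}}"
    then show "P \<in> PG L \<inter> Fr s ` PG L"
      using mem Fr_span[OF u0(3), of s] by (metis IntI imageI singletonD)
  qed
  \<comment> \<open>A natural number that represents the exponent \<open>- s\<close> modulo
    \<open>t\<close>.\<close>
  define s' where "s' = (t - 1) * s"
  have "s + s' = t * s"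
    using t_ge_3 unfolding s'_def by (cases t) auto
  then have s': "(s + s') mod t = 0"
    by simp
  have "coprime (t - 1) t"
    by (rule coprime_diff_one_left_nat) (use t_ge_3 in simp)
  then have "coprime s' t"
    using s unfolding s'_def by (simp only: coprime_mult_left_iff)
  have Frob_s': "Frob s' (Frob s u) = u"
    using s' unfolding Frob_compose by (simp add: add.commute semilin_def)
  show "PG L \<inter> (inv\<^bsub>PGroup\<^esub> (Fr s)) ` PG L = {vec.span {u}}"
    unfolding inv_Fr[OF s']
  proof (intro equalityI subsetI)
    fix P assume "P \<in> PG L \<inter> Fr s' ` PG L"
    then obtain x where x: "x \<in> L" "x \<noteq> 0" "Frob s' x \<in> L" "P = vec.span {Frob s' x}"
      using meet by blast
    have "s' mod t \<noteq> s mod t"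
      using s' ss by (metis mod_add_cong)
    then show "P \<in> {vec.span {u}}"
      using transversal_pair_unique[OF u s \<open>coprime s' t\<close> uv x(1-3)] x(4) by simp
  next
    fix P assume "P \<in> {vec.span {u}}"
    then show "P \<in> PG L \<inter> Fr s' ` PG L"
      using mem Fr_span[OF u0(4), of s'] Frob_s' by (metis IntI imageI singletonD)
  qed
qed

lemma splash_Frob_line:
  assumes L: "vec.subspace L" and u: "nondegenerate u" and s: "coprime s t"
    and uv: "basis2 L u (Frob s u)"
  shows "scattered_linear_set emb L (splash emb W (PG L))"
    and "pseudoregulus_type q L (splash emb W (PG L))"
    and "transversal_points q L (splash emb W (PG L)) = {vec.span {Frob s u}, vec.span {u}}"
proof -
  define v where "v = Frob s u"
  have "L = {x *s u + y *s v | x y. True}"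
    using uv unfolding basis2_def v_def by (rule conjunct1)
  also have "\<dots> = {x *s - v + y *s u | x y. True}"
  proof -
    have "x *s u + y *s v = (- y) *s - v + x *s u" and "x *s - v + y *s u = y *s u + (- x) *s v" for x y
      by (simp_all add: add.commute)
    then show ?thesis
      by blast
  qed
  finally have "L = {x *s - v + y *s u | x y. True}" .
  moreover have "x = 0 \<and> y = 0" if "x *s - v + y *s u = 0" for x y
    using basis2_eqD[OF uv, of y "- x" 0 0] that by (simp add: v_def add.commute)
  ultimately have vu: "basis2 L (- v) u"
    unfolding basis2_def by (intro conjI allI impI) blast+
  \<comment> \<open>Clear for the basis \<open>u\<close>, \<open>Frob s u\<close> by nondegeneracy
    of \<open>u\<close>, and carried to all bases of \<open>L\<close>.\<close>
  have nz: "form a p \<noteq> 0 \<or> form a r \<noteq> 0" if pr: "basis2 L p r" and a: "a \<noteq> 0" for a p r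
    using not_in_hyperplane_iff[OF L pr] not_in_hyperplane_iff[OF L uv] u a
    unfolding nondegenerate_def by blast
  define \<phi> where "\<phi> P = pair_map (- v) u ` P" for P
  have \<phi>: "\<forall>P \<in> PG UNIV. \<phi> P = pair_map (- v) u ` P"
    by (simp add: \<phi>_def)
  have "(\<lambda>a. form a (- (- v)) / form a u) ` (UNIV - {0})
      = (\<lambda>x. x ^ (q ^ s) / x) ` (\<lambda>a. form a u) ` (UNIV - {0})"
    by (simp only: image_image v_def minus_minus form_Frob)
  also have "\<dots> = (\<lambda>x. x ^ q / x) ` (UNIV - {0})"
    by (simp only: image_form_nonzero[OF u] frob_ratio_image[OF s])
  finally have ratio: "(\<lambda>a. form a (- (- v)) / form a u) ` (UNIV - {0}) = (\<lambda>x. x ^ q / x) ` (UNIV - {0})" .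
  have eq: "\<phi> ` pseudoregulus_model q = splash emb W (PG L)"
    by (rule iffD2[OF projectivity_image_splash_iff[OF L vu _ \<phi>]])
      (rule nz[OF vu], assumption, intro conjI u ratio)
  have onto: "projectivity_onto L \<phi>"
    unfolding projectivity_onto_iff using vu \<phi> by blast
  show "scattered_linear_set emb L (splash emb W (PG L))"
    by (rule scattered_if_splash_eq_model[OF L vu _ \<phi> eq]) (rule nz[OF vu])
  show "pseudoregulus_type q L (splash emb W (PG L))"
    unfolding pseudoregulus_type_def using onto eq by blast
  \<comment> \<open>Every admissible projectivity has to be examined, because
    \<open>transversal_points\<close> collects the images under all of them.\<close>
  have "{\<psi> (vec.span {vector [1, 0]}), \<psi> (vec.span {vector [0, 1]})} = {vec.span {v}, vec.span {u}}"
    if \<psi>: "projectivity_onto L \<psi>" "\<psi> ` pseudoregulus_model q = splash emb W (PG L)" for \<psi>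
  proof -
    obtain p r where pr: "basis2 L p r" and \<psi>_eq: "\<forall>P \<in> PG UNIV. \<psi> P = pair_map p r ` P"
      using \<psi>(1) unfolding projectivity_onto_iff by blast
    obtain s' where s': "coprime s' t" "Frob s' r \<in> L" "vec.span {p} = vec.span {Frob s' r}"
      using splash_eq_model_imp_Frob[OF L pr nz[OF pr] \<psi>_eq \<psi>(2)] by blast
    have "{vec.span {Frob s' r}, vec.span {r}} = {vec.span {v}, vec.span {u}}"
      using transversal_pair_unique[OF u s s'(1) uv basis2_memD(2,4)[OF pr] s'(2)]
      unfolding v_def by auto
    then show ?thesis
      using projectivity_span[OF \<psi>_eq, of 1 0] projectivity_span[OF \<psi>_eq, of 0 1] s'(3) by simp
  qed
  then have "transversal_points q L (splash emb W (PG L)) = {vec.span {v}, vec.span {u}}"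
    unfolding transversal_points_def using onto eq by blast
  then show "transversal_points q L (splash emb W (PG L)) = {vec.span {Frob s u}, vec.span {u}}"
    by (simp add: v_def)
qed

lemma generator_meeting_line:
  assumes L: "vec.subspace L" "vec.dim L = 2"
    and disj: "PG L \<inter> PG W = {}"
    and hyp: "\<forall>H \<in> sub_hyperplanes emb W. \<not> PG L \<subseteq> proj_span H"
    and \<sigma>: "stabilizer_generator (PG W) \<sigma>" and meet: "PG L \<inter> \<sigma> ` PG L \<noteq> {}"
  obtains s u where "nondegenerate u" "coprime s t" "basis2 L u (Frob s u)" "\<sigma> = Fr s"
proof -
  obtain \<theta> where \<theta>: "galois \<theta>" "\<sigma> = coll \<theta>"
    using \<sigma> stabilizer_imp_coll unfolding stabilizer_generator_def by blast
  have \<theta>': "field_embedding \<theta>" "\<And>k. \<theta> (emb k) = emb k"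
    using \<theta>(1) by (auto simp: galois_def)
  obtain u where u: "u \<in> L" "u \<noteq> 0" "\<sigma> (vec.span {u}) \<in> PG L"
    using meet by (auto simp: PG_def)
  define v where "v = semilin \<theta> u"
  have "v \<noteq> 0"
    using u(2) by (simp add: v_def semilin_eq_0_iff \<theta>')
  have \<sigma>_u: "\<sigma> (vec.span {u}) = vec.span {v}"
    using u(2) by (simp add: \<theta>(2) v_def coll_span \<theta>')
  have v: "v \<in> L"
    using u(3) \<open>v \<noteq> 0\<close> unfolding \<sigma>_u by (simp add: span_singleton_in_PG_iff[OF L(1)])
  have not_multiple: "v \<noteq> c *s u" for c
  proof
    assume "v = c *s u"
    then have "vec.span {v} = vec.span {u}"
      using \<open>v \<noteq> 0\<close> span_singleton_scale[of c u] by auto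
    then have fix_\<sigma>: "\<sigma> (vec.span {u}) = vec.span {u}"
      using \<sigma>_u by simp
    \<comment> \<open>If \<open>\<sigma>\<close> fixed the point of \<open>u\<close>, so would the
      whole group that it generates, in particular \<open>Fr 1\<close>.\<close>
    have gen: "Fr 1 \<in> generate PGroup {\<sigma>}"
      using \<sigma> coll_in_stabilizer[OF galois_frob, of 1] unfolding stabilizer_generator_def by blast
    have mem: "vec.span {u} \<in> PG UNIV"
      using u(2) by (auto simp: PG_def)
    have "\<sigma> \<in> Bij (PG UNIV)"
      unfolding \<theta>(2) by (rule coll_Bij[OF \<theta>'(1)])
    then have "Fr 1 (vec.span {u}) = vec.span {u}"
      by (rule generate_fixes_point[OF _ mem fix_\<sigma> gen])
    moreover have "Fr 1 (vec.span {u}) = vec.span {Frob 1 u}"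
      by (rule coll_span[OF field_embedding_frob u(2)])
    ultimately have "vec.span {u} = vec.span {Frob 1 u}"
      by (rule trans[OF sym])
    then obtain d where d: "Frob 1 u = d *s u"
      using u(2) unfolding span_singleton_eq_iff[OF u(2)] by blast
    obtain i where i: "coord u $ i \<noteq> 0"
      using u(2) coord_eq_iff[of u 0] by (auto simp: vec_eq_iff)
    \<comment> \<open>Scaling one coordinate to 1 forces the eigenvalue \<open>e\<close> to be 1.
      All coordinates of \<open>w\<close> are then fixed by the \<open>q\<close>-th power and lie in
      the subfield, so the point of \<open>u\<close> would belong to \<Sigma>.\<close>
    define w where "w = (1 / coord u $ i) *s u"
    define e where "e = (1 / coord u $ i) ^ q * d * coord u $ i"
    have Frob_w: "Frob 1 w = e *s w"
      using i unfolding w_def e_def Frob_scale d by simp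
    have eigen: "coord w $ j ^ q = e * coord w $ j" for j
    proof -
      have "coord w $ j ^ q = coord (Frob 1 w) $ j"
        by (simp add: semilin_def)
      then show ?thesis
        unfolding Frob_w by (simp add: coord_scale)
    qed
    have "coord w $ i = 1"
      using i by (simp add: w_def coord_scale)
    then have "e = 1"
      using eigen[of i] by simp
    then have "coord w $ j ^ q = coord w $ j" for j
      using eigen[of j] by simp
    then have "w \<in> W"
      by (simp add: in_W_iff flip: power_q_eq_self_iff)
    moreover have "w \<noteq> 0" "vec.span {w} = vec.span {u}"
      using i u(2) by (auto simp: w_def span_singleton_scale)
    ultimately have "vec.span {u} \<in> PG W"
      unfolding PG_def by blast
    then show False
      using disj u by (auto simp: PG_def)
  qed
  have uv: "basis2 L u v"
  proof (rule basis2_if_independent[OF L u(1) v])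
    fix x y assume eq: "x *s u + y *s v = 0"
    have "y = 0"
    proof (rule ccontr)
      assume "y \<noteq> 0"
      have "y *s v = (- x) *s u"
        using eq by (simp add: eq_neg_iff_add_eq_0 add.commute)
      then have "(1 / y) *s (y *s v) = (1 / y) *s ((- x) *s u)"
        by simp
      then show False
        using \<open>y \<noteq> 0\<close> not_multiple[of "1 / y * (- x)"] by simp
    qed
    then show "x = 0 \<and> y = 0"
      using eq u(2) by simp
  qed
  have nd: "nondegenerate u"
  proof -
    have "form a u \<noteq> 0" if "a \<noteq> 0" for a
    proof
      assume "form a u = 0"
      \<comment> \<open>A form over the subfield commutes with \<open>\<theta>\<close>, so its
        kernel would contain both basis vectors and hence the line.\<close>
      then have "form a v = 0"
        using \<theta>'(2)[of 0] by (simp add: v_def form_semilin[OF \<theta>'])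
      then show False
        using not_in_hyperplane_iff[OF L(1) uv] hyp that \<open>form a u = 0\<close> by blast
    qed
    then show ?thesis
      by (simp add: nondegenerate_def)
  qed
  obtain s where s: "\<theta> = (\<lambda>x. x ^ (q ^ s))"
    using embedding_eq_frob[OF \<theta>' nd] by blast
  have "coprime s t"
    using \<sigma> unfolding \<theta>(2) s by (simp only: stabilizer_generator_Fr_iff[OF nd])
  then show ?thesis
    using that nd uv \<theta>(2) unfolding v_def s by blast
qed

lemma pseudoregulus_splash:
  assumes L: "vec.subspace L" "vec.dim L = 2"
    and disj: "PG L \<inter> PG W = {}"
    and hyp: "\<forall>H \<in> sub_hyperplanes emb W. \<not> PG L \<subseteq> proj_span H"
  shows "(scattered_linear_set emb L (splash emb W (PG L)) \<and> pseudoregulus_type q L (splash emb W (PG L))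
          \<longleftrightarrow> (\<exists>\<sigma>. stabilizer_generator (PG W) \<sigma> \<and> PG L \<inter> \<sigma> ` PG L \<noteq> {}))
    \<and> (\<forall>\<sigma>. stabilizer_generator (PG W) \<sigma> \<and> PG L \<inter> \<sigma> ` PG L \<noteq> {} \<longrightarrow>
          (\<exists>P Q. PG L \<inter> \<sigma> ` PG L = {P} \<and> PG L \<inter> (inv\<^bsub>PGroup\<^esub> \<sigma>) ` PG L = {Q}
             \<and> P \<noteq> Q \<and> transversal_points q L (splash emb W (PG L)) = {P, Q}))"
proof -
  have nz: "form a p \<noteq> 0 \<or> form a r \<noteq> 0" if pr: "basis2 L p r" and a: "a \<noteq> 0" for a p r
    using not_in_hyperplane_iff[OF L(1) pr] hyp a by blast
  have fwd: "\<exists>\<sigma>. stabilizer_generator (PG W) \<sigma> \<and> PG L \<inter> \<sigma> ` PG L \<noteq> {}"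
    if X: "pseudoregulus_type q L (splash emb W (PG L))"
  proof -
    obtain \<phi> p r where pr: "basis2 L p r" and \<phi>: "\<forall>P \<in> PG UNIV. \<phi> P = pair_map p r ` P"
        and eq: "\<phi> ` pseudoregulus_model q = splash emb W (PG L)"
      using X unfolding pseudoregulus_type_def projectivity_onto_iff by blast
    obtain s where s: "nondegenerate r" "coprime s t" "Frob s r \<in> L"
      using splash_eq_model_imp_Frob[OF L(1) pr nz[OF pr] \<phi> eq] by blast
    have r: "r \<in> L" "r \<noteq> 0"
      using basis2_memD[OF pr] by auto
    then have "Fr s (vec.span {r}) = vec.span {Frob s r}" "vec.span {r} \<in> PG L"
        "vec.span {Frob s r} \<in> PG L"
      using s(3) by (auto simp: coll_span field_embedding_frob PG_def semilin_eq_0_iff)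
    then have "PG L \<inter> Fr s ` PG L \<noteq> {}"
      by (metis IntI empty_iff imageI)
    moreover have "stabilizer_generator (PG W) (Fr s)"
      using s(2) by (simp only: stabilizer_generator_Fr_iff[OF s(1)])
    ultimately show ?thesis by blast
  qed
  have bwd: "scattered_linear_set emb L (splash emb W (PG L)) \<and> pseudoregulus_type q L (splash emb W (PG L))
      \<and> (\<exists>P Q. PG L \<inter> \<sigma> ` PG L = {P} \<and> PG L \<inter> (inv\<^bsub>PGroup\<^esub> \<sigma>) ` PG L = {Q}
             \<and> P \<noteq> Q \<and> transversal_points q L (splash emb W (PG L)) = {P, Q})"
    if \<sigma>: "stabilizer_generator (PG W) \<sigma>" "PG L \<inter> \<sigma> ` PG L \<noteq> {}" for \<sigma>
  proof -
    obtain s u where u: "nondegenerate u" and s: "coprime s t" and uv: "basis2 L u (Frob s u)"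
        and \<sigma>_eq: "\<sigma> = Fr s"
      using generator_meeting_line[OF L disj hyp \<sigma>] .
    have "vec.span {Frob s u} \<noteq> vec.span {u}"
    proof (rule not_sym, rule notI)
      assume "vec.span {u} = vec.span {Frob s u}"
      then obtain c where "Frob s u = c *s u"
        using span_singleton_eq_iff[OF basis2_memD(3)[OF uv]] by blast
      then have "c *s u + 0 *s Frob s u = 0 *s u + 1 *s Frob s u"
        by simp
      from basis2_eqD[OF uv this] show False
        by simp
    qed
    then show ?thesis
      unfolding \<sigma>_eq
      by (intro conjI exI[of _ "vec.span {Frob s u}"] exI[of _ "vec.span {u}"]
          splash_Frob_line[OF L(1) u s uv] line_meets_image[OF L(1) u s uv])
  qed
  show ?thesis (is "(?S \<and> ?R \<longleftrightarrow> (\<exists>\<sigma>. ?G \<sigma>)) \<and> (\<forall>\<sigma>. ?G \<sigma> \<longrightarrow> ?T \<sigma>)")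
  proof (rule conjI[OF iffI allI[OF impI]])
    assume "?S \<and> ?R"
    then show "\<exists>\<sigma>. ?G \<sigma>"
      by (rule fwd[OF conjunct2])
  next
    assume "\<exists>\<sigma>. ?G \<sigma>"
    then obtain \<sigma> where "?G \<sigma>" ..
    from bwd[OF conjunct1[OF this] conjunct2[OF this]] show "?S \<and> ?R"
      by (elim conjE, intro conjI)
  next
    fix \<sigma> assume "?G \<sigma>"
    from bwd[OF conjunct1[OF this] conjunct2[OF this]] show "?T \<sigma>"
      by (elim conjE)
  qed
qed

end

text \<open>A basis of \<open>W\<close> over the small field serves as frame. Since \<Sigma> spans
  the whole space, its \<open>t\<close> vectors also span \<open>V\<close> over the large field, so
  \<open>A\<close> is surjective and, by finiteness, bijective.\<close>

lemma ex_canonical_frame: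
  fixes emb :: "'k::{field,finite} \<Rightarrow> 'a::{field,finite}" and W :: "('a ^ 'n) set"
  assumes "CARD('k) = q" "CARD('a) = q ^ t" "field_embedding emb" "CARD('n) = t" "t \<ge> 3"
    and W: "canonical_subgeometry emb W \<Sigma>"
  shows "\<exists>A. canonical_frame emb q t A W"
proof -
  interpret k: vector_space "kscale emb :: 'k \<Rightarrow> 'a ^ 'n \<Rightarrow> 'a ^ 'n"
    by (rule vector_space_kscale) fact
  have W: "k.subspace W" "k.dim W = CARD('n)" "\<Sigma> = PG W" "proj_span \<Sigma> = PG UNIV"
    using W by (auto simp: canonical_subgeometry_def)
  obtain B where B: "B \<subseteq> W" "W \<subseteq> k.span B" "card B = CARD('n)"
    using k.basis_exists[of W] W(2) by metis
  then obtain b :: "'n \<Rightarrow> 'a ^ 'n" where b: "bij_betw b UNIV B"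
    by (metis finite finite_same_card_bij)
  have b_W: "b i \<in> W" for i
    using b B(1) by (auto simp: bij_betw_def)
  define A where "A x = (\<Sum>i\<in>UNIV. x $ i *s b i)" for x
  have A_add: "A (x + y) = A x + A y" and A_scale: "A (c *s x) = c *s A x" for x y c
    by (simp_all add: A_def vec.scale_left_distrib sum.distrib vec.scale_sum_right)
  have A_axis: "A (axis i 1) = b i" for i
  proof -
    have "axis i 1 $ j *s b j = (if j = i then b j else 0)" for j
      by (simp add: axis_def)
    then show ?thesis
      by (simp add: A_def)
  qed
  have linear: "Vector_Spaces.linear (*s) (*s) A"
    by unfold_locales (simp_all add: A_add A_scale)
  have sub: "W \<subseteq> range (\<lambda>a. A (\<chi> i. emb (a $ i)))"
  proof -
    have emb: "emb (x + y) = emb x + emb y" "emb (x * y) = emb x * emb y" "emb 1 = 1" for x y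
      using assms(3) by (auto simp: field_embedding_def)
    have emb_0: "emb 0 = 0"
      using emb(1)[of 0 0] by (metis add_0_right add_left_cancel)
    have "k.subspace (range (\<lambda>a. A (\<chi> i. emb (a $ i))))"
    proof (rule k.subspaceI)
      have "(\<chi> i. emb ((0 :: 'k ^ 'n) $ i)) = 0"
        by (simp add: vec_eq_iff emb_0)
      moreover have "A 0 = 0"
        by (simp add: A_def)
      ultimately show "0 \<in> range (\<lambda>a. A (\<chi> i. emb (a $ i)))"
        by (metis rangeI)
    next
      fix x y assume "x \<in> range (\<lambda>a. A (\<chi> i. emb (a $ i)))" "y \<in> range (\<lambda>a. A (\<chi> i. emb (a $ i)))"
      then obtain a c where "x = A (\<chi> i. emb (a $ i))" "y = A (\<chi> i. emb (c $ i))"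
        by blast
      moreover have "(\<chi> i. emb (a $ i)) + (\<chi> i. emb (c $ i)) = (\<chi> i. emb ((a + c) $ i))"
        by (simp add: vec_eq_iff emb)
      ultimately have "x + y = A (\<chi> i. emb ((a + c) $ i))"
        by (metis A_add)
      then show "x + y \<in> range (\<lambda>a. A (\<chi> i. emb (a $ i)))"
        by blast
    next
      fix c x assume "x \<in> range (\<lambda>a. A (\<chi> i. emb (a $ i)))"
      then obtain a where "x = A (\<chi> i. emb (a $ i))"
        by blast
      moreover have "emb c *s (\<chi> i. emb (a $ i)) = (\<chi> i. emb ((c *s a) $ i))"
        by (simp add: vec_eq_iff emb)
      ultimately have "kscale emb c x = A (\<chi> i. emb ((c *s a) $ i))"
        unfolding kscale_def by (metis A_scale)
      then show "kscale emb c x \<in> range (\<lambda>a. A (\<chi> i. emb (a $ i)))"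
        by blast
    qed
    moreover have "B \<subseteq> range (\<lambda>a. A (\<chi> i. emb (a $ i)))"
    proof
      fix x assume "x \<in> B"
      then obtain i where "x = b i"
        using b by (auto simp: bij_betw_def)
      moreover have "(\<chi> j. emb ((axis i 1 :: 'k ^ 'n) $ j)) = axis i 1"
        by (simp add: vec_eq_iff axis_def emb emb_0)
      ultimately have "x = A (\<chi> j. emb (axis i 1 $ j))"
        using A_axis by metis
      then show "x \<in> range (\<lambda>a. A (\<chi> i. emb (a $ i)))"
        by blast
    qed
    ultimately show ?thesis
      using B(2) k.span_minimal by blast
  qed
  have sup: "range (\<lambda>a. A (\<chi> i. emb (a $ i))) \<subseteq> W"
  proof clarify
    fix a
    have "(\<Sum>i\<in>UNIV. kscale emb (a $ i) (b i)) \<in> W"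
      using W(1) b_W by (intro k.subspace_sum k.subspace_scale)
    then show "A (\<chi> i. emb (a $ i)) \<in> W"
      by (simp add: A_def kscale_def)
  qed
  have "surj A"
  proof -
    have "vec.subspace (range A)"
      unfolding vec.subspace_def
      by (metis (no_types, lifting) A_add A_scale rangeE rangeI vec.scale_zero_left)
    moreover have "W \<subseteq> range A"
      using sub by blast
    ultimately have "vec.span W \<subseteq> range A"
      by (rule vec.span_minimal[rotated])
    moreover have "vec.span W = UNIV"
    proof -
      have "PG UNIV \<subseteq> PG (vec.span W)"
        using W(3,4) by (simp add: proj_span_def span_Union_PG)
      then show ?thesis
        using PG_subset_iff[OF vec.subspace_UNIV vec.subspace_span] by blast
    qed
    ultimately show ?thesis
      by blast
  qed
  then have "bij A"
    by (simp add: bij_def finite_UNIV_surj_inj)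
  have "canonical_frame emb q t A W"
    by (intro canonical_frame.intro finite_field_extension.intro canonical_frame_axioms.intro
        assms(1-5) linear \<open>bij A\<close> subset_antisym[OF sub sup])
  then show ?thesis
    by (rule exI[of _ A])
qed

theorem theorem2p6:
  fixes emb :: "'k::{field,finite} \<Rightarrow> 'a::{field,finite}"
    and W L :: "('a ^ 'n) set"
    and \<Sigma> ell :: "('a ^ 'n) set set"
    and q t :: nat
  assumes "CARD('k) = q" and "CARD('a) = q ^ t" and "field_embedding emb"
    and "CARD('n) = t" and "t \<ge> 3"
    and "canonical_subgeometry emb W \<Sigma>"
    and "vec.subspace L" and "vec.dim L = 2" and "ell = PG L"
    and "ell \<inter> \<Sigma> = {}"
    and "\<forall>H \<in> sub_hyperplanes emb W. \<not> ell \<subseteq> proj_span H"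
  shows "(scattered_linear_set emb L (splash emb W ell) \<and> pseudoregulus_type q L (splash emb W ell)
          \<longleftrightarrow> (\<exists>\<sigma>. stabilizer_generator \<Sigma> \<sigma> \<and> ell \<inter> \<sigma> ` ell \<noteq> {}))
    \<and> (\<forall>\<sigma>. stabilizer_generator \<Sigma> \<sigma> \<and> ell \<inter> \<sigma> ` ell \<noteq> {} \<longrightarrow>
          (\<exists>P Q. ell \<inter> \<sigma> ` ell = {P} \<and> ell \<inter> (inv\<^bsub>BijGroup (PG UNIV)\<^esub> \<sigma>) ` ell = {Q}
             \<and> P \<noteq> Q \<and> transversal_points q L (splash emb W ell) = {P, Q}))"
proof -
  obtain A where "canonical_frame emb q t A W"
    using ex_canonical_frame[OF assms(1-6)] by blast
  then interpret canonical_frame emb q t A W .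
  have \<Sigma>: "\<Sigma> = PG W"
    using assms(6) by (simp add: canonical_subgeometry_def)
  have disj: "PG L \<inter> PG W = {}" and hyp: "\<forall>H \<in> sub_hyperplanes emb W. \<not> PG L \<subseteq> proj_span H"
    using assms(10,11) unfolding assms(9) \<Sigma> by this+
  show ?thesis
    unfolding assms(9) \<Sigma> by (rule pseudoregulus_splash[OF assms(7,8) disj hyp])
qed

end
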